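(* Let $\phi:B_E\to B_E$ be analytic. Assume that (i) for every $0<\delta<1$ the sets $\{\phi(z): z\in B_E,\ \|\phi(z)\|\le \delta\}$ and $\{(1-\|z\|^2)\mathcal R\phi(z): z\in B_E,\ \|\phi(z)\|\le \delta\}$ are relatively compact in $E$; (ii) $\displaystyle\lim_{\|\phi(z)\|\to 1}\frac{(1- \|z\|^2) \|\mathcal R \phi(z)\|}{\sqrt{1- \|\phi(z)\|^2}}=0$; and (iii) $\displaystyle\lim_{\|\phi(z)\|\to 1}\frac{(1- \|z\|^2) |\langle \phi(z), \mathcal R\phi(z)\rangle|}{1- \|\phi(z)\|^2}=0$. Then the composition operator $C_\phi:\mathcal B(B_E)\to \mathcal B(B_E)$, $C_\phi f=f\circ\phi$, is compact.
   Context: $E$ is a complex Hilbert space of arbitrary dimension with inner product $\langle\cdot,\cdot\rangle$ (linear in the first variable) and open unit ball $B_E$. For an analytic map $\phi:B_E\to E$, $\phi'(x)$ denotes its (Fréchet) derivative at $x$ and $\mathcal R\phi(x)=\phi'(x)(x)$ its radial derivative. A limit $\lim_{\|\phi(z)\|\to 1} Q(z)=0$ means: for every $\varepsilon>0$ there is $r<1$ such that $|Q(z)|<\varepsilon$ for all $z\in B_E$ with $\|\phi(z)\|>r$. The Bloch space $\mathcal B(B_E)$ is the space of analytic $f:B_E\to\mathbb C$ with $\|f\|_{\mathcal B(B_E)}=\sup_{x\in B_E}(1-\|x\|^2)\|f'(x)\|<\infty$; it is a Banach space with the norm $\|f\|_{Bloch(B_E)}=|f(0)|+\|f\|_{inv}$,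 where $\|f\|_{inv}=\sup_{x\in B_E}\|\nabla(f\circ\varphi_x)(0)\|$ is an equivalent seminorm; here $\nabla g(x)\in E$ is defined by $g'(x)(y)=\langle y,\overline{\nabla g(x)}\rangle$ with $\overline{z}=\sum_k\overline{z_k}e_k$ for $z=\sum_k z_ke_k$ in a fixed orthonormal basis $(e_k)$, and $\varphi_a$ ($a\in B_E$) is the Möbius automorphism $\varphi_a(x)=(s_aQ_a+P_a)\big(\frac{a-x}{1-\langle x,a\rangle}\big)$, $s_a=\sqrt{1-\|a\|^2}$, $P_a$ the orthogonal projection onto $\mathbb C a$, $Q_a=I-P_a$ (with $\varphi_0(x)=-x$). *)

theory Defs
  imports "HOL-Analysis.Analysis"
begin

text \<open>A complex Hilbert space E is modelled as a real Hilbert space (type class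
  real_inner + complete_space, real inner product = Re of the complex one) together
  with a complex structure J (multiplication by the imaginary unit): J is real-linear,
  J (J x) = -x and J is isometric.\<close>

definition complex_structure :: "('a::real_normed_vector \<Rightarrow> 'a) \<Rightarrow> bool" where
  "complex_structure J \<longleftrightarrow> linear J \<and> (\<forall>x. J (J x) = - x) \<and> (\<forall>x. norm (J x) = norm x)"

definition cscale :: "('a::real_vector \<Rightarrow> 'a) \<Rightarrow> complex \<Rightarrow> 'a \<Rightarrow> 'a" where
  "cscale J c x = Re c *\<^sub>R x + Im c *\<^sub>R J x"

text \<open>complex inner product, linear in the first variable:
  Re <x,y> = x \<bullet> y and Im <x,y> = Re <x, i y> = x \<bullet> J y\<close>
definition cinner :: "('a::real_inner \<Rightarrow> 'a) \<Rightarrow> 'a \<Rightarrow> 'a \<Rightarrow> complex" where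
  "cinner J x y = Complex (inner x y) (inner x (J y))"

text \<open>holomorphic (= analytic) maps on an open set U: complex Frechet differentiable,
  i.e. real Frechet differentiable with complex-linear derivative. J and K are the
  complex structures of the domain and codomain.\<close>
definition holo_on :: "('a::real_normed_vector \<Rightarrow> 'a) \<Rightarrow> ('b::real_normed_vector \<Rightarrow> 'b)
    \<Rightarrow> 'a set \<Rightarrow> ('a \<Rightarrow> 'b) \<Rightarrow> bool" where
  "holo_on J K U f \<longleftrightarrow> (\<forall>x\<in>U. \<exists>D. (f has_derivative D) (at x) \<and> (\<forall>v. D (J v) = K (D v)))"

definition radial_deriv :: "('a::real_normed_vector \<Rightarrow> 'b::real_normed_vector) \<Rightarrow> 'a \<Rightarrow> 'b" where
  "radial_deriv f x = frechet_derivative f (at x) x"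

definition mobius :: "('a::real_inner \<Rightarrow> 'a) \<Rightarrow> 'a \<Rightarrow> 'a \<Rightarrow> 'a" where
  "mobius J a x =
     (let w = cscale J (inverse (1 - cinner J x a)) (a - x);
          p = cscale J (cinner J w a / complex_of_real ((norm a)\<^sup>2)) a
      in sqrt (1 - (norm a)\<^sup>2) *\<^sub>R (w - p) + p)"

definition bloch :: "('a::real_inner \<Rightarrow> 'a) \<Rightarrow> ('a \<Rightarrow> complex) set" where
  "bloch J = {f. holo_on J (\<lambda>z. \<i> * z) (ball 0 1) f \<and>
      bdd_above ((\<lambda>x. (1 - (norm x)\<^sup>2) * onorm (frechet_derivative f (at x))) ` ball 0 1)}"

text \<open>the Bloch norm |f(0)| + sup_x ||nabla (f o phi_x)(0)||; note
  ||nabla g(0)|| equals the operator norm of g'(0)\<close>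
definition bloch_norm :: "('a::real_inner \<Rightarrow> 'a) \<Rightarrow> ('a \<Rightarrow> complex) \<Rightarrow> real" where
  "bloch_norm J f = cmod (f 0) +
     (SUP x\<in>ball 0 1. onorm (frechet_derivative (f \<circ> mobius J x) (at 0)))"

definition compact_composition_bloch :: "('a::real_inner \<Rightarrow> 'a) \<Rightarrow> ('a \<Rightarrow> 'a) \<Rightarrow> bool" where
  "compact_composition_bloch J \<phi> \<longleftrightarrow>
     (\<forall>f\<in>bloch J. f \<circ> \<phi> \<in> bloch J) \<and>
     (\<forall>(F::nat \<Rightarrow> 'a \<Rightarrow> complex) M. (\<forall>n. F n \<in> bloch J \<and> bloch_norm J (F n) \<le> M) \<longrightarrow>
        (\<exists>r g. strict_mono r \<and> g \<in> bloch J \<and>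
           (\<lambda>n. bloch_norm J ((F (r n) \<circ> \<phi>) - g)) \<longlonglongrightarrow> 0))"

end

theory Submission
  imports Defs "HOL-Complex_Analysis.Complex_Analysis"
begin

text \<open>
  Write \<open>s = sqrt (1 - \<parallel>a\<parallel>\<^sup>2)\<close>, let \<open>P\<close> be the orthogonal projection onto the complex line through
  \<open>a\<close> and \<open>Q = 1 - P\<close>. Then \<open>(f \<circ> \<phi>\<^sub>a)'(0) v = - f'(a) (s Q v + s\<^sup>2 P v)\<close>, so the invariant seminorm
  weighs tangential derivatives by \<open>s\<close> and radial ones by \<open>s\<^sup>2\<close>. It is controlled by the radial
  seminorm \<open>sup (1 - \<parallel>z\<parallel>\<^sup>2) \<bar>f'(z) z\<bar>\<close>: the tangential derivative at \<open>a\<close> is compared with the one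
  at \<open>ta\<close> for a suitable \<open>t < 1\<close> by Cauchy's estimate for \<open>f - f(t\<cdot>)\<close>, a contraction that is iterated
  until the origin is near. Hence it suffices to extract from a bounded sequence \<open>F\<^sub>n\<close> a subsequence
  for which \<open>F\<^sub>n \<circ> \<phi>\<close> is Cauchy in the radial seminorm. Where \<open>\<parallel>\<phi>(z)\<parallel>\<close> is close to 1, conditions (ii)
  and (iii) bound \<open>(1 - \<parallel>z\<parallel>\<^sup>2) \<R>\<phi>(z)\<close> in the weighted norm at \<open>\<phi>(z)\<close>. Where \<open>\<parallel>\<phi>(z)\<parallel> \<le> \<delta>\<close>, condition (i)
  puts the complex discs \<open>\<phi>(z) + \<zeta> (1 - \<parallel>z\<parallel>\<^sup>2) \<R>\<phi>(z)\<close>, \<open>\<bar>\<zeta>\<bar> \<le> \<eta>\<close>, into one compact subset of the ball; a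
  diagonal subsequence converges uniformly on these compact sets, and Cauchy's estimate on the
  discs carries this over to the radial derivatives.
\<close>

section \<open>Complex structure and the Moebius derivative\<close>

locale complex_hilbert =
  fixes J :: "'a::{real_inner, complete_space} \<Rightarrow> 'a"
  assumes complex_structure: "complex_structure J"
begin

section \<open>Complex scalars and the complex inner product\<close>

lemma linear_J: "linear J"
  and J_J [simp]: "J (J x) = - x"
  and norm_J [simp]: "norm (J x) = norm x"
  using complex_structure by (auto simp: complex_structure_def)

lemma J_add: "J (x + y) = J x + J y"
  and J_scaleR: "J (r *\<^sub>R x) = r *\<^sub>R J x"
  and J_minus: "J (- x) = - J x"
  and J_zero [simp]: "J 0 = 0"
  using linear_J by (simp_all add: linear_add linear_cmul linear_neg linear_0)

lemma inner_J_J [simp]: "inner (J x) (J y) = inner x y"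
  by (simp add: dot_norm flip: J_add)

lemma inner_J_left: "inner (J x) y = - inner x (J y)"
  using inner_J_J[of "J x" y] by simp

lemma inner_J_self [simp]: "inner x (J x) = 0" "inner (J x) x = 0"
  using inner_J_left[of x x] by (simp_all add: inner_commute)

lemma cscale_minus_right: "cscale J c (- x) = - cscale J c x"
  and cscale_zero_left [simp]: "cscale J 0 x = 0"
  and cscale_zero_right [simp]: "cscale J c 0 = 0"
  and cscale_one [simp]: "cscale J 1 x = x"
  and cscale_of_real: "cscale J (complex_of_real r) x = r *\<^sub>R x"
  by (simp_all add: cscale_def algebra_simps J_minus)

lemma cscale_mult: "cscale J (c * d) x = cscale J c (cscale J d x)"
  by (simp add: cscale_def algebra_simps J_add J_scaleR scaleR_add_left)

lemma norm_cscale: "norm (cscale J c x) = cmod c * norm x"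
proof (rule power2_eq_imp_eq)
  show "(norm (cscale J c x))\<^sup>2 = (cmod c * norm x)\<^sup>2"
    unfolding cscale_def power_mult_distrib cmod_power2 power2_norm_eq_inner
    by (simp add: inner_add_left inner_add_right algebra_simps power2_eq_square)
qed (auto simp: norm_ge_zero)

lemma bounded_bilinear_cscale: "bounded_bilinear (cscale J)"
proof
  show "\<exists>K. \<forall>c x. norm (cscale J c x) \<le> norm c * norm x * K"
    by (intro exI[of _ 1]) (simp add: norm_cscale)
qed (simp_all add: cscale_def algebra_simps J_add J_scaleR)

lemma cinner_add_left: "cinner J (x + y) z = cinner J x z + cinner J y z"
  and cinner_diff_left: "cinner J (x - y) z = cinner J x z - cinner J y z"
  and cinner_minus_left: "cinner J (- x) z = - cinner J x z"
  and cinner_scaleR_left: "cinner J (r *\<^sub>R x) z = complex_of_real r * cinner J x z"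
  and cinner_scaleR_right: "cinner J x (r *\<^sub>R z) = complex_of_real r * cinner J x z"
  and cinner_zero_left [simp]: "cinner J 0 z = 0"
  and cinner_zero_right [simp]: "cinner J x 0 = 0"
  by (simp_all add: cinner_def complex_eq_iff inner_add_left inner_diff_left J_scaleR)

lemma cinner_J_left: "cinner J (J x) y = \<i> * cinner J x y"
  by (simp add: cinner_def complex_eq_iff inner_J_left)

lemma cinner_cscale_left: "cinner J (cscale J c x) y = c * cinner J x y"
  by (simp add: cscale_def cinner_add_left cinner_scaleR_left cinner_J_left complex_eq_iff)

lemma cinner_self: "cinner J x x = complex_of_real ((norm x)\<^sup>2)"
  by (simp add: cinner_def complex_eq_iff power2_norm_eq_inner)

lemma cinner_commute: "cinner J x y = cnj (cinner J y x)"
  using inner_J_left[of x y] by (simp add: cinner_def complex_eq_iff inner_commute)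

lemma cmod_cinner_commute: "cmod (cinner J x y) = cmod (cinner J y x)"
  by (metis cinner_commute complex_mod_cnj)

text \<open>The norm depends on \<open>c\<close> only through its modulus, so a complex disc
  orthogonal to \<open>a\<close> stays in the ball while its radius is below
  \<open>sqrt (1 - (norm a)\<^sup>2)\<close>. This is the room exploited for tangential
  derivatives.\<close>

lemma norm_add_cscale_orth:
  assumes "cinner J q a = 0"
  shows "(norm (a + cscale J c q))\<^sup>2 = (norm a)\<^sup>2 + (cmod c * norm q)\<^sup>2"
proof -
  have "cinner J (cscale J c q) a = 0" using assms by (simp add: cinner_cscale_left)
  then have "inner (cscale J c q) a = 0" by (simp add: cinner_def complex_eq_iff)
  then show ?thesis
    by (simp add: power2_norm_eq_inner inner_add_left inner_add_right inner_commute
        flip: norm_cscale)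
qed

section \<open>Orthogonal projection onto a complex line\<close>

definition cproj :: "'a \<Rightarrow> 'a \<Rightarrow> 'a" where
  "cproj a v = cscale J (cinner J v a / complex_of_real ((norm a)\<^sup>2)) a"

lemma cproj_add: "cproj a (u + v) = cproj a u + cproj a v"
  and cproj_diff: "cproj a (u - v) = cproj a u - cproj a v"
  and cproj_minus: "cproj a (- v) = - cproj a v"
  and cproj_scaleR: "cproj a (r *\<^sub>R v) = r *\<^sub>R cproj a v"
  by (simp_all add: cproj_def cinner_add_left cinner_diff_left cinner_minus_left cinner_scaleR_left
      add_divide_distrib diff_divide_distrib)
    (simp_all add: cscale_def algebra_simps diff_divide_distrib)

lemma cproj_cscale: "cproj a (cscale J c v) = cscale J c (cproj a v)"
  by (simp add: cproj_def cinner_cscale_left flip: cscale_mult)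

text \<open>For \<open>a = 0\<close> the projection is the zero map, in agreement with
  \<open>mobius J 0 x = - x\<close>.\<close>

lemma cproj_self [simp]: "cproj a a = a"
  by (cases "a = 0") (simp_all add: cproj_def cinner_self)

lemma cproj_idem [simp]: "cproj a (cproj a v) = cproj a v"
  using cproj_cscale[of a _ a] by (simp add: cproj_def[of a v])

lemma cinner_cproj: "cinner J (cproj a v) a = cinner J v a"
  by (cases "a = 0") (simp_all add: cproj_def cinner_cscale_left cinner_self)

lemma cinner_diff_cproj [simp]: "cinner J (v - cproj a v) a = 0"
  by (simp add: cinner_diff_left cinner_cproj)

text \<open>The difference is orthogonal to \<open>a\<close>, hence to the multiple
  \<open>cproj a v\<close> of \<open>a\<close>; then \<open>norm_add_cscale_orth\<close> applies
  with \<open>c = 1\<close>.\<close>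

lemma norm_cproj_pythagoras: "(norm v)\<^sup>2 = (norm (cproj a v))\<^sup>2 + (norm (v - cproj a v))\<^sup>2"
proof -
  let ?q = "v - cproj a v"
  have "cinner J ?q (cproj a v) = cnj (cinner J (cproj a v) ?q)" by (rule cinner_commute)
  also have "cinner J (cproj a v) ?q = 0"
    using cinner_commute[of a ?q] by (simp add: cproj_def[of a v] cinner_cscale_left del: cinner_diff_cproj)
      (simp flip: cproj_def of_real_power)
  finally show ?thesis
    using norm_add_cscale_orth[of ?q "cproj a v" 1] by simp
qed

lemma norm_cproj_le: "norm (cproj a v) \<le> norm v"
  and norm_diff_cproj_le: "norm (v - cproj a v) \<le> norm v"
proof -
  show "norm (cproj a v) \<le> norm v"
    by (rule power2_le_imp_le) (simp_all add: norm_cproj_pythagoras[of v a])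
  show "norm (v - cproj a v) \<le> norm v"
    by (rule power2_le_imp_le) (simp_all add: norm_cproj_pythagoras[of v a])
qed

lemma norm_cproj: "norm (cproj a v) = cmod (cinner J v a) / norm a"
  by (cases "a = 0") (simp_all add: cproj_def norm_cscale norm_divide norm_power norm_mult power2_eq_square)

text \<open>Cauchy-Schwarz, read off from the contractivity of the projection onto the line through
  \<open>y\<close>.\<close>

lemma cmod_cinner_le: "cmod (cinner J x y) \<le> norm x * norm y"
  using norm_cproj_le[of y x] by (cases "y = 0") (simp_all add: norm_cproj field_simps)

lemma bounded_linear_cproj: "bounded_linear (cproj a)"
  by (rule bounded_linear_intro[of _ 1]) (simp_all add: cproj_add cproj_scaleR norm_cproj_le)

text \<open>Up to sign, the derivative at the origin of the Moebius map sending 0 to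
  \<open>a\<close>.\<close>

definition anis :: "'a \<Rightarrow> 'a \<Rightarrow> 'a" where
  "anis a v = sqrt (1 - (norm a)\<^sup>2) *\<^sub>R (v - cproj a v) + (1 - (norm a)\<^sup>2) *\<^sub>R cproj a v"

lemma mobius_zero [simp]: "mobius J a 0 = a"
proof -
  have "mobius J a 0 = sqrt (1 - (norm a)\<^sup>2) *\<^sub>R (a - cproj a a) + cproj a a"
    by (simp add: mobius_def Let_def cproj_def del: cproj_self)
  then show ?thesis by simp
qed

text \<open>The quotient \<open>?w\<close> has derivative \<open><v,a> a - v\<close> at 0. The first
  term is a multiple of \<open>a\<close>, so the complement of the projection leaves only
  \<open>- (v - cproj a v)\<close>; the projection turns that term into
  \<open>(norm a)\<^sup>2 *\<^sub>R cproj a v\<close>, which combines with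
  \<open>- cproj a v\<close>.\<close>

lemma mobius_has_derivative: "(mobius J a has_derivative (\<lambda>v. - anis a v)) (at 0)"
proof -
  let ?s = "sqrt (1 - (norm a)\<^sup>2)"
  let ?w = "\<lambda>x. cscale J (inverse (1 - cinner J x a)) (a - x)"
  have bl: "bounded_linear (\<lambda>x. cinner J x a)"
    by (rule bounded_linear_intro[of _ "norm a"])
      (simp_all add: cinner_add_left cinner_scaleR_left cmod_cinner_le scaleR_conv_of_real)
  have 1: "((\<lambda>x. inverse (1 - cinner J x a)) has_derivative (\<lambda>v. cinner J v a)) (at 0)"
    by (rule derivative_eq_intros bounded_linear.has_derivative[OF bl] | simp)+
  have 2: "(?w has_derivative (\<lambda>v. cscale J (cinner J v a) a - v)) (at 0)"
    by (rule has_derivative_eq_rhs,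
        rule bounded_bilinear.FDERIV[OF bounded_bilinear_cscale 1])
      (auto intro!: derivative_eq_intros simp: fun_eq_iff cscale_minus_right)
  have p: "cproj a (cscale J (cinner J v a) a - v) = - (1 - (norm a)\<^sup>2) *\<^sub>R cproj a v" for v
  proof (cases "a = 0")
    case False
    have "cscale J (cinner J v a) a = (norm a)\<^sup>2 *\<^sub>R cproj a v"
      using False by (simp add: cproj_def flip: cscale_of_real cscale_mult)
    then show ?thesis by (simp add: cproj_diff cproj_scaleR algebra_simps)
  qed (simp add: cproj_minus)
  have q: "cscale J (cinner J v a) a - v - cproj a (cscale J (cinner J v a) a - v)
      = - (v - cproj a v)" for v
    by (simp add: cproj_diff cproj_cscale)
  have "((\<lambda>x. ?s *\<^sub>R (?w x - cproj a (?w x)) + cproj a (?w x)) has_derivative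
      (\<lambda>v. ?s *\<^sub>R (cscale J (cinner J v a) a - v - cproj a (cscale J (cinner J v a) a - v))
         + cproj a (cscale J (cinner J v a) a - v))) (at 0)"
    by (intro derivative_intros 2 bounded_linear.has_derivative[OF bounded_linear_cproj])
  moreover have "mobius J a = (\<lambda>x. ?s *\<^sub>R (?w x - cproj a (?w x)) + cproj a (?w x))"
    by (simp add: fun_eq_iff mobius_def Let_def cproj_def)
  moreover have "(\<lambda>v. ?s *\<^sub>R (cscale J (cinner J v a) a - v - cproj a (cscale J (cinner J v a) a - v))
         + cproj a (cscale J (cinner J v a) a - v)) = (\<lambda>v. - anis a v)"
    unfolding q unfolding p by (simp add: fun_eq_iff anis_def algebra_simps)
  ultimately show ?thesis by simp
qed


section \<open>The radial derivative controls the invariant gradient\<close>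

abbreviation hol :: "('a \<Rightarrow> complex) \<Rightarrow> bool" where
  "hol f \<equiv> holo_on J (\<lambda>z. \<i> * z) (ball 0 1) f"

abbreviation D :: "('a \<Rightarrow> complex) \<Rightarrow> 'a \<Rightarrow> 'a \<Rightarrow> complex" where
  "D f x \<equiv> frechet_derivative f (at x)"

lemma hol_has_derivative:
  assumes "hol f" "norm x < 1"
  shows "(f has_derivative D f x) (at x)"
proof -
  have "f differentiable (at x)"
    using assms unfolding holo_on_def differentiable_def by (metis mem_ball_0)
  then show ?thesis by (simp add: frechet_derivative_works)
qed

lemma hol_D_J:
  assumes "hol f" "norm x < 1"
  shows "D f x (J v) = \<i> * D f x v"
proof -
  obtain E where "(f has_derivative E) (at x)" "\<And>v. E (J v) = \<i> * E v"
    using assms unfolding holo_on_def by (metis mem_ball_0)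
  then show ?thesis using frechet_derivative_at by metis
qed

lemma hol_bounded_linear_D:
  assumes "hol f" "norm x < 1"
  shows "bounded_linear (D f x)"
  using hol_has_derivative[OF assms] by (rule has_derivative_bounded_linear)

lemma hol_D_add:
  assumes "hol f" "norm x < 1"
  shows "D f x (u + v) = D f x u + D f x v"
  using hol_bounded_linear_D[OF assms] by (simp add: bounded_linear.linear linear_add)

lemma hol_D_scaleR:
  assumes "hol f" "norm x < 1"
  shows "D f x (r *\<^sub>R v) = r *\<^sub>R D f x v"
  using hol_bounded_linear_D[OF assms] by (simp add: bounded_linear.linear linear_cmul)

lemma hol_D_cscale:
  assumes "hol f" "norm x < 1"
  shows "D f x (cscale J c v) = c * D f x v"
  using assms
  by (simp add: cscale_def hol_D_add hol_D_scaleR hol_D_J complex_eq_iff)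

lemma hol_intro:
  assumes "\<And>x. norm x < 1 \<Longrightarrow> (f has_derivative E x) (at x)"
    and "\<And>x v. norm x < 1 \<Longrightarrow> E x (J v) = \<i> * E x v"
  shows "hol f"
  using assms unfolding holo_on_def by (metis mem_ball_0)

lemma D_eq: "(f has_derivative E) (at x) \<Longrightarrow> D f x = E"
  using frechet_derivative_at by metis

lemma has_derivative_diff_fun:
  assumes "hol f" "hol g" "norm x < 1"
  shows "((f - g) has_derivative (\<lambda>v. D f x v - D g x v)) (at x)"
proof -
  have "((\<lambda>x. f x - g x) has_derivative (\<lambda>v. D f x v - D g x v)) (at x)"
    using assms by (intro derivative_intros hol_has_derivative)
  then show ?thesis by (simp add: fun_diff_def)
qed

lemma hol_diff:
  assumes "hol f" "hol g"
  shows "hol (f - g)"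
  by (rule hol_intro, rule has_derivative_diff_fun)
    (use assms in \<open>simp_all add: hol_D_J algebra_simps\<close>)

lemma D_diff:
  assumes "hol f" "hol g" "norm x < 1"
  shows "D (f - g) x v = D f x v - D g x v"
  using D_eq[OF has_derivative_diff_fun[OF assms]] by simp

lemma norm_dilate_less:
  assumes "norm (x :: 'a) < 1" "0 \<le> t" "t \<le> 1"
  shows "norm (t *\<^sub>R x) < 1"
  using mult_left_le_one_le[of "norm x" t] assms by simp

lemma has_derivative_dilate:
  assumes "hol f" "norm x < 1" "0 \<le> t" "t \<le> 1"
  shows "((\<lambda>x. f (t *\<^sub>R x)) has_derivative (\<lambda>v. t *\<^sub>R D f (t *\<^sub>R x) v)) (at x)"
proof -
  have "((\<lambda>x. f (t *\<^sub>R x)) has_derivative (\<lambda>v. D f (t *\<^sub>R x) (t *\<^sub>R v))) (at x)"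
    by (rule has_derivative_compose[OF _ hol_has_derivative, of "\<lambda>x. t *\<^sub>R x"])
      (use assms norm_dilate_less in \<open>auto intro!: derivative_eq_intros\<close>)
  then show ?thesis using assms norm_dilate_less by (simp add: hol_D_scaleR)
qed

lemma hol_dilate:
  assumes "hol f" "0 \<le> t" "t \<le> 1"
  shows "hol (\<lambda>x. f (t *\<^sub>R x))"
  by (rule hol_intro, rule has_derivative_dilate)
    (use assms norm_dilate_less in \<open>auto simp: hol_D_J\<close>)

text \<open>Complex linearity of the derivative makes the restriction to a complex line holomorphic
  in one variable; through this the classical theorems enter.\<close>

lemma hol_line:
  assumes "hol f" "norm (w + cscale J z u) < 1"
  shows "((\<lambda>z. f (w + cscale J z u)) has_field_derivative D f (w + cscale J z u) u) (at z)"
proof -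
  have bl: "bounded_linear (\<lambda>z. cscale J z u)"
    by (rule bounded_bilinear.bounded_linear_left[OF bounded_bilinear_cscale])
  have "((\<lambda>z. w + cscale J z u) has_derivative (\<lambda>z. cscale J z u)) (at z)"
    by (auto intro!: derivative_eq_intros bounded_linear.has_derivative[OF bl])
  then have "((\<lambda>z. f (w + cscale J z u)) has_derivative
      (\<lambda>z'. D f (w + cscale J z u) (cscale J z' u))) (at z)"
    using hol_has_derivative[OF assms] by (rule has_derivative_compose)
  then show ?thesis
    using assms by (simp add: hol_D_cscale has_field_derivative_def mult_commute_abs)
qed

lemma continuous_line: "continuous_on S (\<lambda>z. w + cscale J z u)"
  by (intro continuous_on_add continuous_on_const linear_continuous_on
      bounded_bilinear.bounded_linear_left[OF bounded_bilinear_cscale])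

text \<open>The one-variable Cauchy inequality for \<open>z \<mapsto> f (w + z u)\<close>, whose
  derivative at 0 is \<open>D f w u\<close>. Only the disc in direction \<open>u\<close> has to fit
  into the ball.\<close>

lemma cauchy_estimate:
  assumes f: "hol f" and R: "0 < R"
    and *: "\<And>z. cmod z \<le> R \<Longrightarrow> norm (w + cscale J z u) < 1"
    and B: "\<And>z. cmod z = R \<Longrightarrow> cmod (f (w + cscale J z u)) \<le> B"
  shows "cmod (D f w u) \<le> B / R"
proof -
  let ?g = "\<lambda>z. f (w + cscale J z u)"
  have der: "(?g has_field_derivative D f (w + cscale J z u) u) (at z)" if "cmod z \<le> R" for z
    using hol_line[OF f *[OF that]] .
  have "?g holomorphic_on ball 0 R"
    unfolding holomorphic_on_def field_differentiable_def
    using der by (meson DERIV_subset less_imp_le mem_ball_0 subset_UNIV)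
  moreover have "continuous_on (cball 0 R) ?g"
    using der by (meson DERIV_isCont continuous_at_imp_continuous_on mem_cball_0)
  ultimately have "cmod ((deriv ^^ 1) ?g 0) \<le> fact 1 * B / R ^ 1"
    using R B by (intro Cauchy_inequality) (auto simp: norm_minus_commute)
  moreover have "deriv ?g 0 = D f w u"
    using DERIV_imp_deriv[OF der[of 0]] R by simp
  ultimately show ?thesis by simp
qed

text \<open>The bound on the derivative of \<open>\<zeta> \<mapsto> f (\<zeta>x)\<close> is known only up to a factor
  \<open>1 / \<bar>\<zeta>\<bar>\<close>, which the maximum principle on the unit disc removes.\<close>

lemma radial_increment:
  assumes f: "hol f" and x: "norm x < 1" and t: "0 \<le> t" "t \<le> 1"
    and S: "\<And>z. norm z < 1 \<Longrightarrow> (1 - (norm z)\<^sup>2) * cmod (D f z z) \<le> S"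
  shows "cmod (f x - f (t *\<^sub>R x)) \<le> (1 - t) * (S / (1 - (norm x)\<^sup>2))"
proof -
  let ?u = "\<lambda>z. f (0 + cscale J z x)"
  let ?h = "\<lambda>z. D f (0 + cscale J z x) x"
  \<comment> \<open>An open neighbourhood of the closed unit disc, since \<open>norm x < 1\<close>.
    On it \<open>?h\<close>, as a complex derivative, is itself holomorphic, which the maximum
    principle requires.\<close>
  define U where "U = {z. norm (cscale J z x) < 1}"
  have der: "(?u has_field_derivative ?h z) (at z)" if "z \<in> U" for z
    by (rule hol_line[OF f]) (use that in \<open>simp add: U_def\<close>)
  have U: "open U"
    unfolding U_def using continuous_line[of UNIV 0 x]
    by (intro open_Collect_less continuous_intros) auto
  have sub: "cball 0 1 \<subseteq> U"
  proof
    fix z :: complex assume "z \<in> cball 0 1"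
    then show "z \<in> U"
      using x mult_left_le_one_le[of "norm x" "cmod z"] by (simp add: U_def norm_cscale)
  qed
  have "?u holomorphic_on U"
    unfolding holomorphic_on_def field_differentiable_def
    using der by (meson DERIV_subset subset_UNIV)
  then have "deriv ?u holomorphic_on U" using U by (rule holomorphic_deriv)
  then have h: "?h holomorphic_on U"
    by (rule holomorphic_transform) (rule DERIV_imp_deriv[OF der])
  have bound: "cmod (?h z) \<le> S / (1 - (norm x)\<^sup>2)" if "z \<in> cball 0 1" for z
  proof (rule maximum_modulus_frontier[where f = ?h and S = "cball 0 1"])
    show "?h holomorphic_on interior (cball 0 1)"
      using h holomorphic_on_subset interior_subset sub by blast
    show "continuous_on (closure (cball 0 1)) ?h"
      using h sub by (simp add: holomorphic_on_imp_continuous_on holomorphic_on_subset)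
    show "cmod (?h z) \<le> S / (1 - (norm x)\<^sup>2)" if "z \<in> frontier (cball 0 1)" for z
    proof -
      have z: "cmod z = 1" using that by simp
      have n: "norm (cscale J z x) = norm x" by (simp add: norm_cscale z)
      have "cmod (D f (cscale J z x) (cscale J z x)) = cmod (?h z)"
        using f x n by (simp add: hol_D_cscale norm_mult z)
      then have "(1 - (norm x)\<^sup>2) * cmod (?h z) \<le> S" using S[of "cscale J z x"] n x by simp
      moreover have "0 < 1 - (norm x)\<^sup>2" using x by (simp add: abs_square_less_1)
      ultimately show ?thesis by (simp add: field_simps)
    qed
  qed (use that in auto)
  \<comment> \<open>Both 1 and \<open>t\<close> lie in the closed disc, which is convex, so the
    bound on \<open>?h\<close> integrates to one on the increment.\<close>
  have "cmod (?u 1 - ?u (of_real t)) \<le> (S / (1 - (norm x)\<^sup>2)) * cmod (1 - of_real t)"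
  proof (rule field_differentiable_bound[of "cball 0 1" ?u ?h])
    show "(?u has_field_derivative ?h z) (at z within cball 0 1)" if "z \<in> cball 0 1" for z
      using der sub that has_field_derivative_at_within by blast
  qed (use bound t in auto)
  moreover have "cmod (1 - of_real t) = 1 - t"
    using t by (metis abs_of_nonneg diff_ge_0_iff_ge norm_of_real of_real_1 of_real_diff)
  ultimately show ?thesis by (simp add: cscale_of_real mult.commute)
qed

text \<open>Away from the sphere no weight is critical: \<open>f - f 0\<close> is bounded by
  \<open>S / 0.3\<close> on the disc of radius 1/8 about \<open>a\<close> in direction
  \<open>v\<close>, and Cauchy's estimate gives the derivative.\<close>

lemma radial_controls_near_origin:
  assumes f: "hol f" and a: "(norm a)\<^sup>2 \<le> 1/2"
    and S: "\<And>z. norm z < 1 \<Longrightarrow> (1 - (norm z)\<^sup>2) * cmod (D f z z) \<le> S"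
  shows "cmod (D f a v) \<le> 27 * S * norm v"
proof (cases "v = 0")
  case True
  have "norm a < 1" using a by (intro power2_less_imp_less[of _ 1]) auto
  then show ?thesis using True bounded_linear.linear[OF hol_bounded_linear_D[OF f]] by (simp add: linear_0)
next
  case False
  have S0: "0 \<le> S" using order_trans[OF _ S[of 0], of 0] by simp
  \<comment> \<open>A bound just above \<open>1 / sqrt 2\<close>. Then 0.7072 + 1/8 = 0.8322,
    \<open>1 - 0.8322\<^sup>2\<close> exceeds 0.3, and 8 / 0.3 = 80/3 is below 27.\<close>
  have "norm a \<le> 0.7072"
    by (rule power2_le_imp_le) (use a in \<open>auto simp: power2_eq_square\<close>)
  \<comment> \<open>The constant \<open>f 0\<close> is written as the dilate with
    \<open>t = 0\<close>, so that the lemmas on dilates apply to it.\<close>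
  define g where "g = f - (\<lambda>x. f (0 *\<^sub>R x))"
  have g: "hol g" unfolding g_def by (intro hol_diff hol_dilate f) auto
  define R where "R = 1/8 / norm v"
  have R: "0 < R" "R * norm v = 1/8" using False by (auto simp: R_def)
  have near: "norm (a + cscale J z v) \<le> 0.8322" if "cmod z \<le> R" for z
  proof -
    have "cmod z * norm v \<le> R * norm v" using that by (intro mult_right_mono) auto
    then show ?thesis using norm_triangle_ineq[of a "cscale J z v"] \<open>norm a \<le> 0.7072\<close> R
      by (simp add: norm_cscale)
  qed
  have "cmod (D g a v) \<le> (S / 0.3) / R"
  proof (rule cauchy_estimate[OF g R(1)])
    fix z :: complex assume z: "cmod z = R"
    let ?y = "a + cscale J z v"
    have y: "norm ?y \<le> 0.8322" using near z by simp
    then have "(norm ?y)\<^sup>2 \<le> 0.8322\<^sup>2" by (intro power_mono) auto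
    then have "0.3 \<le> 1 - (norm ?y)\<^sup>2" by (simp add: power2_eq_square)
    then have "S / (1 - (norm ?y)\<^sup>2) \<le> S / 0.3" using S0 by (intro divide_left_mono) auto
    moreover have "cmod (g ?y) \<le> (1 - 0) * (S / (1 - (norm ?y)\<^sup>2))"
      unfolding g_def fun_diff_def
      by (rule radial_increment[OF f _ _ _ S]) (use y in auto)
    ultimately show "cmod (g ?y) \<le> S / 0.3"
      unfolding diff_zero mult_1 by (rule order_trans[rotated])
  qed (use near in force)
  also have "(S / 0.3) / R = (80/3) * S * norm v" using False by (simp add: R_def)
  also have "\<dots> \<le> 27 * S * norm v" using S0 by (intro mult_right_mono) auto
  finally have "cmod (D g a v) \<le> 27 * S * norm v" .
  moreover have "norm a < 1" using \<open>norm a \<le> 0.7072\<close> by simp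
  then have "D g a v = D f a v"
    unfolding g_def using D_diff[OF f hol_dilate[OF f], of 0 a v] D_eq[OF has_derivative_dilate[OF f, of a 0]]
    by simp
  ultimately show ?thesis by simp
qed

text \<open>With \<open>1 - \<parallel>ta\<parallel>\<^sup>2 = 2 (1 - \<parallel>a\<parallel>\<^sup>2)\<close>, Cauchy's estimate for \<open>f - f(t\<cdot>)\<close> bounds the weighted
  tangential derivative at \<open>a\<close> by \<open>4\<surd>2 S\<close> plus \<open>1/\<surd>2\<close> times that at \<open>ta\<close>: a contraction.\<close>

lemma radial_controls_tangential:
  assumes f: "hol f" and a: "norm a < 1" and q: "cinner J q a = 0"
    and S: "\<And>z. norm z < 1 \<Longrightarrow> (1 - (norm z)\<^sup>2) * cmod (D f z z) \<le> S"
  shows "sqrt (1 - (norm a)\<^sup>2) * cmod (D f a q) \<le> 27 * S * norm q"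
proof -
  have S0: "0 \<le> S" using order_trans[OF _ S[of 0], of 0] by simp
  have small: "sqrt (1 - (norm a)\<^sup>2) * cmod (D f a q) \<le> 27 * S * norm q"
    if "(norm a)\<^sup>2 \<le> 1/2" for a q
  proof -
    have "sqrt (1 - (norm a)\<^sup>2) * cmod (D f a q) \<le> 1 * cmod (D f a q)"
      by (intro mult_right_mono) auto
    then show ?thesis using radial_controls_near_origin[OF f that S, of q] by simp
  qed
  \<comment> \<open>Each induction step passes to \<open>t a\<close>, where
    \<open>1 - norm^2\<close> has doubled, so the exponent \<open>n\<close> drops by one.\<close>
  have main: "sqrt (1 - (norm a)\<^sup>2) * cmod (D f a q) \<le> 27 * S * norm q"
    if "(1/2) ^ n \<le> 1 - (norm a)\<^sup>2" "norm a < 1" "cinner J q a = 0" for n a q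
    using that
  proof (induction n arbitrary: a q)
    case 0
    then show ?case by (intro small) simp
  next
    case (Suc n)
    show ?case
    proof (cases "(norm a)\<^sup>2 \<le> 1/2 \<or> q = 0")
      case True
      then show ?thesis using small Suc.prems bounded_linear.linear[OF hol_bounded_linear_D[OF f]]
        by (auto simp: linear_0)
    next
      case False
      then have big: "1/2 < (norm a)\<^sup>2" and "q \<noteq> 0" by auto
      define s where "s = sqrt (1 - (norm a)\<^sup>2)"
      have a1: "(norm a)\<^sup>2 < 1" using Suc.prems by (simp add: abs_square_less_1)
      then have s: "0 < s" "s\<^sup>2 = 1 - (norm a)\<^sup>2" by (auto simp: s_def)
      define t where "t = sqrt (2 - 1 / (norm a)\<^sup>2)"
      have "a \<noteq> 0" using big by auto
      then have "1 / (norm a)\<^sup>2 < 2" "1 < 1 / (norm a)\<^sup>2"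
        using big a1 by (simp_all add: pos_divide_less_eq)
      then have t: "0 < t" "t \<le> 1" "t\<^sup>2 = 2 - 1 / (norm a)\<^sup>2"
        by (auto simp: t_def real_le_lsqrt)
      have ta: "1 - (norm (t *\<^sub>R a))\<^sup>2 = 2 * s\<^sup>2"
      proof -
        have "(norm (t *\<^sub>R a))\<^sup>2 = (2 - 1 / (norm a)\<^sup>2) * (norm a)\<^sup>2"
          by (simp add: power_mult_distrib t)
        also have "\<dots> = 2 * (norm a)\<^sup>2 - 1" using \<open>a \<noteq> 0\<close> by (simp add: algebra_simps)
        finally show ?thesis by (simp add: s)
      qed
      \<comment> \<open>The increment between \<open>t y\<close> and \<open>y\<close> carries the
        factor \<open>1 - t\<close>; being of order \<open>s\<^sup>2\<close>, it cancels the blow-up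
        of \<open>S / (1 - norm^2)\<close> near the sphere.\<close>
      have t': "1 - t \<le> 2 * s\<^sup>2"
      proof -
        have "1 - t \<le> 1 - t\<^sup>2" using mult_left_le_one_le[of t t] t(1,2) by (simp add: power2_eq_square)
        also have "\<dots> = (1 - (norm a)\<^sup>2) / (norm a)\<^sup>2" using \<open>a \<noteq> 0\<close> by (simp add: t field_simps)
        also have "\<dots> \<le> 2 * (1 - (norm a)\<^sup>2)"
        proof -
          have "(1 - (norm a)\<^sup>2) * 1 \<le> (1 - (norm a)\<^sup>2) * (2 * (norm a)\<^sup>2)"
            using a1 big by (intro mult_left_mono) auto
          then have "1 - (norm a)\<^sup>2 \<le> (2 * (1 - (norm a)\<^sup>2)) * (norm a)\<^sup>2"
            by (simp only: mult_ac mult_1_left)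
          then show ?thesis using \<open>a \<noteq> 0\<close> by (subst pos_divide_le_eq) auto
        qed
        finally show ?thesis by (simp add: s)
      qed
      define g where "g = f - (\<lambda>x. f (t *\<^sub>R x))"
      have g: "hol g" unfolding g_def using t by (intro hol_diff hol_dilate f) auto
      \<comment> \<open>The disc has geometric radius \<open>s / sqrt 2\<close>; by orthogonality
        \<open>1 - norm^2\<close> remains at least \<open>s\<^sup>2 / 2\<close> on it.\<close>
      define R where "R = s / sqrt 2 / norm q"
      have R: "0 < R" "R * norm q = s / sqrt 2" using s \<open>q \<noteq> 0\<close> by (auto simp: R_def)
      have nrm: "(norm (a + cscale J z q))\<^sup>2 = (norm a)\<^sup>2 + (cmod z * norm q)\<^sup>2" for z
        using Suc.prems by (intro norm_add_cscale_orth)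
      have le: "(norm (a + cscale J z q))\<^sup>2 \<le> 1 - s\<^sup>2 / 2" if "cmod z \<le> R" for z
      proof -
        have "cmod z * norm q \<le> R * norm q" using that by (intro mult_right_mono) auto
        then have "(cmod z * norm q)\<^sup>2 \<le> (s / sqrt 2)\<^sup>2" unfolding R by (intro power_mono) auto
        then have "(cmod z * norm q)\<^sup>2 \<le> s\<^sup>2 / 2" by (simp add: power_divide)
        then show ?thesis unfolding nrm using s(2) by linarith
      qed
      have lt: "norm (a + cscale J z q) < 1" if "cmod z \<le> R" for z
      proof -
        have "(norm (a + cscale J z q))\<^sup>2 < 1" using le[OF that] zero_less_power[OF s(1), of 2] by linarith
        then show ?thesis by (simp add: abs_square_less_1)
      qed
      have "cmod (D g a q) \<le> (4 * S) / R"
      proof (rule cauchy_estimate[OF g R(1) lt])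
        fix z :: complex assume z: "cmod z = R"
        let ?y = "a + cscale J z q"
        have "s\<^sup>2 / 2 \<le> 1 - (norm ?y)\<^sup>2" using le[of z] z by simp
        then have "S / (1 - (norm ?y)\<^sup>2) \<le> S / (s\<^sup>2 / 2)"
          using S0 s(1) zero_less_power[OF s(1), of 2]
          by (intro divide_left_mono mult_pos_pos) (linarith | simp)+
        then have "(1 - t) * (S / (1 - (norm ?y)\<^sup>2)) \<le> (2 * s\<^sup>2) * (S / (s\<^sup>2 / 2))"
          using t' S0 lt[of z] z by (intro mult_mono) (auto simp: abs_square_le_1 less_imp_le)
        also have "\<dots> = 4 * S" using s(1) by simp
        finally have "(1 - t) * (S / (1 - (norm ?y)\<^sup>2)) \<le> 4 * S" .
        moreover have "cmod (g ?y) \<le> (1 - t) * (S / (1 - (norm ?y)\<^sup>2))"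
          unfolding g_def fun_diff_def
          by (rule radial_increment[OF f _ _ _ S]) (use lt[of z] z t in auto)
        ultimately show "cmod (g ?y) \<le> 4 * S" by simp
      qed
      also have "(4 * S) / R = 4 * sqrt 2 * S * norm q / s" by (simp add: R_def)
      finally have gle: "s * cmod (D g a q) \<le> 4 * sqrt 2 * S * norm q"
        using s(1) by (simp add: field_simps)
      have ta1: "norm (t *\<^sub>R a) < 1" using Suc.prems t by (intro norm_dilate_less) auto
      have "sqrt (1 - (norm (t *\<^sub>R a))\<^sup>2) * cmod (D f (t *\<^sub>R a) q) \<le> 27 * S * norm q"
      proof (rule Suc.IH[OF _ ta1])
        show "(1/2) ^ n \<le> 1 - (norm (t *\<^sub>R a))\<^sup>2" unfolding ta using Suc.prems s by simp
        show "cinner J q (t *\<^sub>R a) = 0" using Suc.prems by (simp add: cinner_scaleR_right)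
      qed
      then have IH: "sqrt 2 * (s * cmod (D f (t *\<^sub>R a) q)) \<le> 27 * S * norm q"
        unfolding ta using s(1) by (simp add: real_sqrt_mult)
      have "D g a q = D f a q - t *\<^sub>R D f (t *\<^sub>R a) q"
        unfolding g_def
        using D_diff[OF f hol_dilate[OF f], of t a q] D_eq[OF has_derivative_dilate[OF f, of a t]] t Suc.prems
        by simp
      then have "cmod (D f a q) \<le> cmod (D g a q) + cmod (t *\<^sub>R D f (t *\<^sub>R a) q)"
        by (metis diff_add_cancel norm_triangle_ineq)
      also have "\<dots> \<le> cmod (D g a q) + cmod (D f (t *\<^sub>R a) q)"
        using t by (simp add: mult_left_le_one_le)
      finally have "s * cmod (D f a q) \<le> s * cmod (D g a q) + s * cmod (D f (t *\<^sub>R a) q)"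
        using s(1) by (simp flip: distrib_left)
      also have "\<dots> \<le> 4 * sqrt 2 * S * norm q + s * cmod (D f (t *\<^sub>R a) q)" using gle by simp
      \<comment> \<open>The factor \<open>sqrt 2\<close> brings in the induction hypothesis. The
        total is 8 + 27 = 35 times \<open>S * norm q\<close>, and 35 is below
        \<open>27 * sqrt 2\<close>, so the constant 27 reproduces itself.\<close>
      finally have "sqrt 2 * (s * cmod (D f a q)) \<le> sqrt 2 * (4 * sqrt 2 * S * norm q + s * cmod (D f (t *\<^sub>R a) q))"
        by (intro mult_left_mono) auto
      also have "\<dots> = (sqrt 2 * sqrt 2) * (4 * S * norm q) + sqrt 2 * (s * cmod (D f (t *\<^sub>R a) q))"
        by (simp only: distrib_left mult_ac)
      also have "\<dots> \<le> 8 * (S * norm q) + 27 * (S * norm q)" using IH by simp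
      also have "\<dots> \<le> sqrt 2 * (27 * (S * norm q))"
      proof -
        have "35 / 27 \<le> sqrt 2" by (rule real_le_rsqrt) (simp add: power2_eq_square)
        then have "(35 / 27) * (27 * (S * norm q)) \<le> sqrt 2 * (27 * (S * norm q))"
          using S0 by (intro mult_right_mono) auto
        then show ?thesis by simp
      qed
      finally show ?thesis unfolding s_def[symmetric] by simp
    qed
  qed
  have "0 < 1 - (norm a)\<^sup>2" using a by (simp add: abs_square_less_1)
  then obtain n where "(1/2) ^ n < 1 - (norm a)\<^sup>2"
    using real_arch_pow_inv[of "1 - (norm a)\<^sup>2" "1/2"] by auto
  then show ?thesis using main[OF _ a q, of n] by simp
qed

text \<open>Near the origin, 27 is applied to a vector of norm at most \<open>2 * norm v\<close>,
  which gives 54. Elsewhere the tangential part costs 27, and \<open>cproj a v\<close>, a multiple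
  of \<open>a\<close>, costs only 2 because \<open>1/2 \<le> norm a\<close>.\<close>

lemma radial_controls_anis:
  assumes f: "hol f" and a: "norm a < 1"
    and S: "\<And>z. norm z < 1 \<Longrightarrow> (1 - (norm z)\<^sup>2) * cmod (D f z z) \<le> S"
  shows "cmod (D f a (anis a v)) \<le> 54 * S * norm v"
proof (cases "(norm a)\<^sup>2 \<le> 1/2")
  case True
  have S0: "0 \<le> S" using order_trans[OF _ S[of 0], of 0] by simp
  have "norm (anis a v) \<le> 1 * norm (v - cproj a v) + 1 * norm (cproj a v)"
    unfolding anis_def
    by (rule order_trans[OF norm_triangle_ineq add_mono])
      (use a in \<open>auto simp: abs_square_le_1 intro!: mult_left_le_one_le\<close>)
  also have "\<dots> \<le> 2 * norm v"
    using norm_cproj_le[of a v] norm_diff_cproj_le[of v a] by simp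
  finally have "27 * S * norm (anis a v) \<le> 27 * S * (2 * norm v)"
    using S0 by (intro mult_left_mono) auto
  then show ?thesis using radial_controls_near_origin[OF f True S, of "anis a v"] by simp
next
  case False
  have S0: "0 \<le> S" using order_trans[OF _ S[of 0], of 0] by simp
  let ?q = "v - cproj a v" and ?c = "cinner J v a / complex_of_real ((norm a)\<^sup>2)"
  have a0: "1/2 \<le> norm a"
  proof (rule power2_le_imp_le)
    show "(1/2)\<^sup>2 \<le> (norm a)\<^sup>2" using False by (simp add: power2_eq_square)
  qed simp
  have s: "0 < 1 - (norm a)\<^sup>2" using a by (simp add: abs_square_less_1)
  have "D f a (anis a v) = sqrt (1 - (norm a)\<^sup>2) *\<^sub>R D f a ?q + (1 - (norm a)\<^sup>2) *\<^sub>R D f a (cproj a v)"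
    unfolding anis_def using f a by (simp add: hol_D_add hol_D_scaleR)
  also have "cmod \<dots> \<le> sqrt (1 - (norm a)\<^sup>2) * cmod (D f a ?q) + (1 - (norm a)\<^sup>2) * cmod (D f a (cproj a v))"
    using s by (intro order_trans[OF norm_triangle_ineq]) simp
  also have "D f a (cproj a v) = ?c * D f a a" unfolding cproj_def using f a by (rule hol_D_cscale)
  also have "(1 - (norm a)\<^sup>2) * cmod (?c * D f a a) = cmod ?c * ((1 - (norm a)\<^sup>2) * cmod (D f a a))"
    by (simp only: norm_mult mult_ac)
  also have "\<dots> \<le> cmod ?c * S" using S[OF a] by (intro mult_left_mono) auto
  also have "cmod ?c \<le> 2 * norm v"
  proof -
    have "cmod ?c * norm a \<le> norm v"
      using norm_cproj_le[of a v] by (simp add: cproj_def norm_cscale)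
    moreover have "cmod ?c * (1/2) \<le> cmod ?c * norm a" using a0 by (intro mult_left_mono) auto
    ultimately show ?thesis by linarith
  qed
  also have "sqrt (1 - (norm a)\<^sup>2) * cmod (D f a ?q) \<le> 27 * S * norm ?q"
    by (rule radial_controls_tangential[OF f a _ S]) simp_all
  also have "norm ?q \<le> norm v" by (rule norm_diff_cproj_le)
  finally have "cmod (D f a (anis a v)) \<le> 27 * S * norm v + 2 * norm v * S"
    using S0 by (simp add: mult_left_mono mult_right_mono)
  also have "\<dots> \<le> 54 * S * norm v" using S0 by (simp add: mult.commute)
  finally show ?thesis .
qed


section \<open>The Bloch norm\<close>

text \<open>A bound on the radial seminorm, phrased as a predicate so that no real supremum of a
  possibly unbounded set arises.\<close>

definition radial_bound :: "('a \<Rightarrow> complex) \<Rightarrow> real \<Rightarrow> bool" where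
  "radial_bound f S \<longleftrightarrow> (\<forall>z. norm z < 1 \<longrightarrow> (1 - (norm z)\<^sup>2) * cmod (D f z z) \<le> S)"

lemma one_minus_norm_sq_pos: "norm (x :: 'a) < 1 \<Longrightarrow> 0 < 1 - (norm x)\<^sup>2"
  by (simp add: abs_square_less_1)

lemma radial_bound_anis:
  "hol f \<Longrightarrow> radial_bound f S \<Longrightarrow> norm a < 1 \<Longrightarrow> cmod (D f a (anis a v)) \<le> 54 * S * norm v"
  unfolding radial_bound_def using radial_controls_anis by blast

lemma radial_bound_nonneg: "radial_bound f S \<Longrightarrow> 0 \<le> S"
proof -
  assume "radial_bound f S"
  then have "cmod (D f 0 0) \<le> S" unfolding radial_bound_def by (elim allE[of _ 0]) simp
  then show "0 \<le> S" using norm_ge_zero[of "D f 0 0"] by linarith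
qed

text \<open>\<open>anis w\<close> is inverted by dividing the tangential part by \<open>s\<close>
  and the projected part by \<open>s\<^sup>2\<close>. The two summands are the kinds of quotient
  that conditions (ii) and (iii) make small.\<close>

lemma anis_preimage:
  assumes w: "norm w < 1"
  obtains v where "anis w v = u"
    "norm v \<le> norm u / sqrt (1 - (norm w)\<^sup>2) + norm (cproj w u) / (1 - (norm w)\<^sup>2)"
proof
  let ?s2 = "1 - (norm w)\<^sup>2"
  have s2: "0 < ?s2" using w by (rule one_minus_norm_sq_pos)
  define v where "v = (1 / sqrt ?s2) *\<^sub>R (u - cproj w u) + (1 / ?s2) *\<^sub>R cproj w u"
  have p: "cproj w v = (1 / ?s2) *\<^sub>R cproj w u"
    unfolding v_def cproj_add cproj_scaleR cproj_diff by simp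
  have q: "v - cproj w v = (1 / sqrt ?s2) *\<^sub>R (u - cproj w u)"
    unfolding p by (simp add: v_def)
  show "anis w v = u"
    unfolding anis_def q unfolding p using s2 by simp
  have "norm v \<le> (1 / sqrt ?s2) * norm (u - cproj w u) + (1 / ?s2) * norm (cproj w u)"
    unfolding v_def by (rule order_trans[OF norm_triangle_ineq]) (use s2 in simp)
  also have "\<dots> \<le> (1 / sqrt ?s2) * norm u + (1 / ?s2) * norm (cproj w u)"
    using s2 by (intro add_mono mult_left_mono norm_diff_cproj_le) auto
  finally show "norm v \<le> norm u / sqrt ?s2 + norm (cproj w u) / ?s2" by simp
qed

text \<open>Since \<open>s\<^sup>2 \<le> s\<close>, the preimage of \<open>u\<close> under
  \<open>anis w\<close> has norm at most \<open>2 * norm u / s\<^sup>2\<close>. This turns an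
  invariant bound into one with the usual Bloch weight.\<close>

lemma D_le_of_anis:
  assumes w: "norm w < 1" and B: "\<And>v. cmod (D f w (anis w v)) \<le> B * norm v"
  shows "(1 - (norm w)\<^sup>2) * cmod (D f w u) \<le> 2 * B * norm u"
proof -
  let ?s2 = "1 - (norm w)\<^sup>2"
  have s2: "0 < ?s2" using w by (rule one_minus_norm_sq_pos)
  obtain v where v: "anis w v = u" "norm v \<le> norm u / sqrt ?s2 + norm (cproj w u) / ?s2"
    using anis_preimage[OF w] by blast
  have "?s2 \<le> sqrt ?s2" using s2 by (intro real_le_rsqrt) (simp add: power2_eq_square mult_left_le_one_le)
  then have "norm u / sqrt ?s2 \<le> norm u / ?s2" using s2 by (intro divide_left_mono) auto
  moreover have "norm (cproj w u) / ?s2 \<le> norm u / ?s2"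
    using s2 by (intro divide_right_mono norm_cproj_le) auto
  ultimately have "norm v \<le> 2 * norm u / ?s2" using v(2) by simp
  then have *: "?s2 * norm v \<le> 2 * norm u" using s2 by (simp add: pos_le_divide_eq mult.commute)
  show ?thesis
  proof (cases "u = 0")
    case True
    then have "norm v = 0" using * s2 by (simp add: mult_le_0_iff)
    then have "cmod (D f w u) \<le> 0" using B[of v] v(1) by simp
    then show ?thesis using True by simp
  next
    case False
    \<comment> \<open>A nonzero \<open>v\<close> allows the sign of \<open>B\<close> to be read off
      from its defining inequality.\<close>
    then have "v \<noteq> 0" using v(1) by (auto simp: anis_def cproj_def)
    moreover have "0 \<le> B * norm v" using B[of v] norm_ge_zero order_trans by blast
    ultimately have "0 \<le> B" by (simp add: zero_le_mult_iff)
    have "?s2 * cmod (D f w u) \<le> ?s2 * (B * norm v)"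
      using B[of v] v(1) s2 by (intro mult_left_mono) auto
    also have "\<dots> = B * (?s2 * norm v)" by simp
    also have "\<dots> \<le> B * (2 * norm u)" using * \<open>0 \<le> B\<close> by (intro mult_left_mono)
    finally show ?thesis by simp
  qed
qed

lemma radial_bound_D:
  assumes "hol f" "radial_bound f S" "norm w < 1"
  shows "(1 - (norm w)\<^sup>2) * cmod (D f w u) \<le> 108 * S * norm u"
  using D_le_of_anis[OF assms(3) radial_bound_anis[OF assms], of u] by simp

section \<open>The seminorm as a supremum over Moebius maps\<close>

lemma comp_mobius_has_derivative:
  assumes "hol f" "norm a < 1"
  shows "(f \<circ> mobius J a has_derivative (\<lambda>v. - D f a (anis a v))) (at 0)"
proof -
  have "(f has_derivative D f a) (at (mobius J a 0))"
    using hol_has_derivative[OF assms] by simp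
  then have "(f \<circ> mobius J a has_derivative (\<lambda>v. D f a (- anis a v))) (at 0)"
    unfolding o_def by (rule has_derivative_compose[OF mobius_has_derivative])
  moreover have "D f a (- x) = - D f a x" for x
    using hol_D_scaleR[OF assms, of "-1"] by simp
  ultimately show ?thesis by simp
qed

lemma D_mobius:
  assumes "hol f" "norm a < 1"
  shows "D (f \<circ> mobius J a) 0 = (\<lambda>v. - D f a (anis a v))"
  by (rule D_eq[OF comp_mobius_has_derivative[OF assms]])

lemma bounded_linear_D_mobius:
  assumes "hol f" "norm a < 1"
  shows "bounded_linear (D (f \<circ> mobius J a) 0)"
  unfolding D_mobius[OF assms]
  by (rule has_derivative_bounded_linear[OF comp_mobius_has_derivative[OF assms]])

lemma onorm_D_mobius_le:
  assumes "hol f" "radial_bound f S" "norm a < 1"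
  shows "onorm (D (f \<circ> mobius J a) 0) \<le> 54 * S"
  using assms by (intro onorm_bound) (simp_all add: D_mobius radial_bound_anis radial_bound_nonneg)

text \<open>Makes the real supremum in \<open>bloch_norm\<close> a genuine upper bound of its
  members.\<close>

lemma bdd_above_mobius:
  assumes "hol f" "radial_bound f S"
  shows "bdd_above ((\<lambda>x. onorm (D (f \<circ> mobius J x) 0)) ` ball 0 1)"
  using onorm_D_mobius_le[OF assms] by (intro bdd_aboveI2[of _ _ "54 * S"]) auto

lemma bloch_norm_le:
  assumes "hol f" "radial_bound f S"
  shows "bloch_norm J f \<le> cmod (f 0) + 54 * S"
  unfolding bloch_norm_def
  using onorm_D_mobius_le[OF assms] by (intro add_left_mono cSUP_least) auto

lemma onorm_D_mobius_le_bloch_norm: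
  assumes "hol f" "radial_bound f S" "norm a < 1"
  shows "cmod (f 0) + onorm (D (f \<circ> mobius J a) 0) \<le> bloch_norm J f"
  unfolding bloch_norm_def
  using assms(3) by (intro add_left_mono cSUP_upper bdd_above_mobius[OF assms(1,2)]) auto

lemma bloch_hol: "f \<in> bloch J \<Longrightarrow> hol f"
  by (simp add: bloch_def)

text \<open>Together with \<open>blochI\<close> this shows that radial derivatives alone decide
  membership in the Bloch space.\<close>

lemma bloch_radial_bound:
  assumes "f \<in> bloch J"
  obtains S where "radial_bound f S"
proof -
  have f: "hol f" using assms by (rule bloch_hol)
  obtain S where S: "\<And>x. norm x < 1 \<Longrightarrow> (1 - (norm x)\<^sup>2) * onorm (D f x) \<le> S"
    using assms unfolding bloch_def bdd_above_def by fastforce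
  have "(1 - (norm z)\<^sup>2) * cmod (D f z z) \<le> S" if z: "norm z < 1" for z
  proof -
    have bl: "bounded_linear (D f z)" using f z by (rule hol_bounded_linear_D)
    have "cmod (D f z z) \<le> onorm (D f z) * norm z" by (rule onorm[OF bl])
    also have "\<dots> \<le> onorm (D f z)" using z onorm_pos_le[OF bl] by (simp add: mult_left_le)
    finally have "(1 - (norm z)\<^sup>2) * cmod (D f z z) \<le> (1 - (norm z)\<^sup>2) * onorm (D f z)"
      using one_minus_norm_sq_pos[OF z] by (intro mult_left_mono) auto
    then show ?thesis using S[OF z] by linarith
  qed
  then show ?thesis using that by (auto simp: radial_bound_def)
qed

lemma blochI:
  assumes "hol f" "radial_bound f S"
  shows "f \<in> bloch J"
proof -
  have "(1 - (norm x)\<^sup>2) * onorm (D f x) \<le> 108 * S" if x: "norm x < 1" for x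
  proof -
    have s: "0 < 1 - (norm x)\<^sup>2" using x by (rule one_minus_norm_sq_pos)
    have "onorm (D f x) \<le> 108 * S / (1 - (norm x)\<^sup>2)"
    proof (rule onorm_bound)
      show "0 \<le> 108 * S / (1 - (norm x)\<^sup>2)" using s radial_bound_nonneg[OF assms(2)] by simp
      show "cmod (D f x v) \<le> 108 * S / (1 - (norm x)\<^sup>2) * norm v" for v
        using radial_bound_D[OF assms x, of v] s by (simp add: field_simps)
    qed
    then show ?thesis using s by (simp add: field_simps)
  qed
  then show ?thesis using assms(1) by (auto simp: bloch_def intro!: bdd_aboveI2[of _ _ "108 * S"])
qed

lemma bloch_norm_bounds:
  assumes "f \<in> bloch J"
  shows bloch_norm_nonneg: "0 \<le> bloch_norm J f"
    and cmod_zero_le_bloch_norm: "cmod (f 0) \<le> bloch_norm J f"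
    and anis_le_bloch_norm: "norm a < 1 \<Longrightarrow> cmod (D f a (anis a v)) \<le> bloch_norm J f * norm v"
proof -
  obtain S where S: "radial_bound f S" using assms by (rule bloch_radial_bound)
  note f = bloch_hol[OF assms]
  have *: "cmod (f 0) + onorm (D (f \<circ> mobius J a) 0) \<le> bloch_norm J f" "0 \<le> onorm (D (f \<circ> mobius J a) 0)"
    if "norm a < 1" for a
    using onorm_D_mobius_le_bloch_norm[OF f S that] onorm_pos_le[OF bounded_linear_D_mobius[OF f that]]
    by auto
  show "cmod (f 0) \<le> bloch_norm J f" using *[of 0] by simp
  then show "0 \<le> bloch_norm J f" using norm_ge_zero order_trans by blast
  show "cmod (D f a (anis a v)) \<le> bloch_norm J f * norm v" if a: "norm a < 1"
  proof -
    have "cmod (D f a (anis a v)) \<le> onorm (D (f \<circ> mobius J a) 0) * norm v"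
      using onorm[OF bounded_linear_D_mobius[OF f a], of v] by (simp add: D_mobius[OF f a])
    also have "\<dots> \<le> bloch_norm J f * norm v"
      using *[OF a] norm_ge_zero[of "f 0"] by (intro mult_right_mono) (linarith | simp)+
    finally show ?thesis .
  qed
qed

section \<open>Lipschitz and growth estimates for norm-bounded families\<close>

lemma bloch_lipschitz:
  assumes f: "f \<in> bloch J" and M: "bloch_norm J f \<le> M" and \<rho>: "\<rho> < 1"
    and x: "norm x \<le> \<rho>" and y: "norm y \<le> \<rho>"
  shows "cmod (f x - f y) \<le> 2 * M / (1 - \<rho>\<^sup>2) * norm (x - y)"
proof (rule differentiable_bound[of "cball 0 \<rho>" f "D f"])
  have \<rho>0: "0 \<le> \<rho>" using x norm_ge_zero order_trans by blast
  then have s\<rho>: "0 < 1 - \<rho>\<^sup>2" using \<rho> by (simp add: abs_square_less_1)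
  have M0: "0 \<le> M" using bloch_norm_nonneg[OF f] M by simp
  fix z :: 'a assume "z \<in> cball 0 \<rho>"
  then have z: "norm z \<le> \<rho>" "norm z < 1" using \<rho> by auto
  show "(f has_derivative D f z) (at z within cball 0 \<rho>)"
    using hol_has_derivative[OF bloch_hol[OF f] z(2)] has_derivative_at_withinI by blast
  show "onorm (D f z) \<le> 2 * M / (1 - \<rho>\<^sup>2)"
  proof (rule onorm_bound)
    show "0 \<le> 2 * M / (1 - \<rho>\<^sup>2)" using M0 s\<rho> by simp
    fix v
    have "(1 - \<rho>\<^sup>2) * cmod (D f z v) \<le> (1 - (norm z)\<^sup>2) * cmod (D f z v)"
      using power_mono[OF z(1), of 2] by (intro mult_right_mono) auto
    also have "\<dots> \<le> 2 * bloch_norm J f * norm v"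
      by (rule D_le_of_anis[OF z(2) anis_le_bloch_norm[OF f z(2)]])
    also have "\<dots> \<le> 2 * M * norm v" using M by (intro mult_right_mono) auto
    finally show "cmod (D f z v) \<le> 2 * M / (1 - \<rho>\<^sup>2) * norm v"
      using s\<rho> by (simp add: field_simps)
  qed
qed (use x y in auto)

text \<open>A crude growth rate, obtained from the Lipschitz bound between 0 and \<open>x\<close>;
  it suffices to bound a whole weighted family by one constant.\<close>

lemma bloch_growth:
  assumes f: "f \<in> bloch J" and M: "bloch_norm J f \<le> M" and x: "norm x < 1"
  shows "(1 - (norm x)\<^sup>2) * cmod (f x) \<le> 3 * M"
proof -
  let ?s = "1 - (norm x)\<^sup>2"
  have s: "0 < ?s" using x by (rule one_minus_norm_sq_pos)
  have M0: "0 \<le> M" using bloch_norm_nonneg[OF f] M by simp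
  have "cmod (f x) \<le> cmod (f 0) + cmod (f x - f 0)"
    using norm_triangle_ineq[of "f 0" "f x - f 0"] by simp
  also have "\<dots> \<le> M + 2 * M / ?s * norm x"
    using bloch_lipschitz[OF f M x, of x 0] cmod_zero_le_bloch_norm[OF f] M by simp
  finally have "?s * cmod (f x) \<le> ?s * (M + 2 * M / ?s * norm x)"
    using s by (intro mult_left_mono) auto
  also have "\<dots> = ?s * M + 2 * (M * norm x)" using s by (simp add: field_simps)
  also have "\<dots> \<le> 1 * M + 2 * (M * 1)"
    using x M0 by (intro add_mono mult_right_mono mult_left_mono) auto
  finally show ?thesis by simp
qed

section \<open>Completeness with respect to the radial seminorm\<close>

lemma radial_cauchy_D:
  assumes G: "hol f" "hol g" and S: "radial_bound (f - g) S" and z: "norm z < 1"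
  shows "(1 - (norm z)\<^sup>2) * cmod (D f z v - D g z v) \<le> 108 * S * norm v"
  using radial_bound_D[OF hol_diff[OF G] S z, of v] D_diff[OF G z] by simp

text \<open>A radial bound controls the derivatives in all directions, uniformly on smaller balls.
  Hence the derivatives converge, and the theorem on differentiating limits, started from the values
  at 0, yields the limit function.\<close>

lemma bloch_complete_radial:
  assumes G: "\<And>n. G n \<in> bloch J"
    and cauchy: "\<And>e. 0 < e \<Longrightarrow> \<exists>N. \<forall>m\<ge>N. \<forall>n\<ge>N. radial_bound (G m - G n) e"
    and conv0: "(\<lambda>n. G n 0) \<longlonglongrightarrow> l"
  shows "\<exists>g\<in>bloch J. (\<lambda>n. bloch_norm J (G n - g)) \<longlonglongrightarrow> 0"
proof -
  have hG: "hol (G n)" for n using G bloch_hol by blast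
  have "Cauchy (\<lambda>n. D (G n) z v)" if z: "norm z < 1" for z v
  proof (rule CauchyI)
    fix e :: real assume e: "0 < e"
    have s: "0 < 1 - (norm z)\<^sup>2" using z by (rule one_minus_norm_sq_pos)
    \<comment> \<open>The summand 1 keeps the denominator positive when
      \<open>v = 0\<close>.\<close>
    define e' where "e' = (1 - (norm z)\<^sup>2) * e / (108 * (norm v + 1))"
    have pos: "0 < 108 * (norm v + 1)" by (simp add: add_nonneg_pos)
    have e': "0 < e'" using s e pos by (simp add: e'_def)
    obtain N where N: "\<And>m n. N \<le> m \<Longrightarrow> N \<le> n \<Longrightarrow> radial_bound (G m - G n) e'"
      using cauchy[OF e'] by blast
    have "cmod (D (G m) z v - D (G n) z v) < e" if "N \<le> m" "N \<le> n" for m n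
    proof -
      have "(1 - (norm z)\<^sup>2) * cmod (D (G m) z v - D (G n) z v) \<le> 108 * e' * norm v"
        by (rule radial_cauchy_D[OF hG hG N[OF that] z])
      also have "\<dots> < e' * (108 * (norm v + 1))" using e' by simp
      also have "\<dots> = (1 - (norm z)\<^sup>2) * e" using pos by (simp add: e'_def)
      finally show ?thesis using s by simp
    qed
    then show "\<exists>N. \<forall>m\<ge>N. \<forall>n\<ge>N. cmod (D (G m) z v - D (G n) z v) < e" by blast
  qed
  then have "\<exists>E. \<forall>z v. norm z < 1 \<longrightarrow> (\<lambda>n. D (G n) z v) \<longlonglongrightarrow> E z v"
    unfolding Cauchy_convergent_iff convergent_def by metis
  then obtain E where E: "\<And>z v. norm z < 1 \<Longrightarrow> (\<lambda>n. D (G n) z v) \<longlonglongrightarrow> E z v"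
    by blast
  \<comment> \<open>Let \<open>m\<close> tend to infinity in \<open>radial_cauchy_D\<close>.\<close>
  have limD: "(1 - (norm z)\<^sup>2) * cmod (D (G n) z v - E z v) \<le> 108 * e * norm v"
    if N: "\<And>m n. N \<le> m \<Longrightarrow> N \<le> n \<Longrightarrow> radial_bound (G m - G n) e" and n: "N \<le> n" and z: "norm z < 1"
    for N n z v e
  proof (rule tendsto_upperbound)
    show "(\<lambda>m. (1 - (norm z)\<^sup>2) * cmod (D (G n) z v - D (G m) z v))
        \<longlonglongrightarrow> (1 - (norm z)\<^sup>2) * cmod (D (G n) z v - E z v)"
      by (intro tendsto_intros E z)
    show "\<forall>\<^sub>F m in sequentially. (1 - (norm z)\<^sup>2) * cmod (D (G n) z v - D (G m) z v) \<le> 108 * e * norm v"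
      using eventually_ge_at_top[of N]
      by eventually_elim (rule radial_cauchy_D[OF hG hG N z], use n in auto)
  qed simp
  \<comment> \<open>One global pointwise limit, with which the local limits \<open>h\<close> on
    different balls must agree.\<close>
  define g where "g x = lim (\<lambda>n. G n x)" for x
  have local_lim: "(\<lambda>n. G n x) \<longlonglongrightarrow> g x \<and> (g has_derivative E x) (at x)" if x: "norm x < 1" for x
  proof -
    \<comment> \<open>On the ball of radius \<open>\<rho>\<close> the weight is at least
      \<open>1 - \<rho>\<^sup>2\<close>, so the weighted estimates become uniform convergence of
      derivatives.\<close>
    obtain \<rho> where \<rho>: "norm x < \<rho>" "\<rho> < 1" using x dense by blast
    have \<rho>0: "0 < \<rho>" using \<rho>(1) norm_ge_zero[of x] by linarith
    have s: "0 < 1 - \<rho>\<^sup>2" using \<rho> \<rho>0 by (simp add: abs_square_less_1)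
    have "\<exists>h. \<forall>y\<in>ball 0 \<rho>. (\<lambda>n. G n y) \<longlonglongrightarrow> h y \<and> (h has_derivative E y) (at y within ball 0 \<rho>)"
    proof (rule has_derivative_sequence[where f' = "\<lambda>n. D (G n)"])
      show "(G n has_derivative D (G n) y) (at y within ball 0 \<rho>)" if "y \<in> ball 0 \<rho>" for n y
        using hol_has_derivative[OF hG, of y n] that \<rho> has_derivative_at_withinI by fastforce
      show "(\<lambda>n. G n 0) \<longlonglongrightarrow> l" by (rule conv0)
      fix e :: real assume e: "0 < e"
      define e' where "e' = (1 - \<rho>\<^sup>2) * e / 108"
      have e': "0 < e'" using s e by (simp add: e'_def)
      obtain N where N: "\<And>m n. N \<le> m \<Longrightarrow> N \<le> n \<Longrightarrow> radial_bound (G m - G n) e'"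
        using cauchy[OF e'] by blast
      have "cmod (D (G n) y v - E y v) \<le> e * norm v" if n: "N \<le> n" and y: "norm y < \<rho>" for n y v
      proof -
        have y1: "norm y < 1" using y \<rho> by simp
        have "(1 - \<rho>\<^sup>2) * cmod (D (G n) y v - E y v) \<le> (1 - (norm y)\<^sup>2) * cmod (D (G n) y v - E y v)"
          using power_mono[OF less_imp_le[OF y], of 2] by (intro mult_right_mono) auto
        also have "\<dots> \<le> 108 * e' * norm v" by (rule limD[OF N n y1])
        also have "\<dots> = (1 - \<rho>\<^sup>2) * (e * norm v)" by (simp add: e'_def)
        finally show ?thesis using s by (simp only: mult_le_cancel_left_pos)
      qed
      then show "\<forall>\<^sub>F n in sequentially. \<forall>y\<in>ball 0 \<rho>. \<forall>v. cmod (D (G n) y v - E y v) \<le> e * norm v"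
        unfolding eventually_sequentially by (intro exI[of _ N]) simp
    qed (use \<rho>0 in auto)
    then obtain h where h: "\<And>y. y \<in> ball 0 \<rho> \<Longrightarrow> (\<lambda>n. G n y) \<longlonglongrightarrow> h y"
      "\<And>y. y \<in> ball 0 \<rho> \<Longrightarrow> (h has_derivative E y) (at y within ball 0 \<rho>)" by blast
    have gh: "g y = h y" if "y \<in> ball 0 \<rho>" for y
      unfolding g_def using h(1)[OF that] by (rule limI)
    have xb: "x \<in> ball 0 \<rho>" using \<rho> by simp
    have "(h has_derivative E x) (at x)"
      using h(2)[OF xb] xb by (simp add: at_within_open[of x "ball 0 \<rho>"])
    then have "(g has_derivative E x) (at x)"
      by (rule has_derivative_transform_within_open[OF _ open_ball xb]) (simp add: gh)
    then show ?thesis using h(1)[OF xb] gh[OF xb] by simp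
  qed
  have hg: "hol g"
  proof (rule hol_intro)
    show "(g has_derivative E x) (at x)" if "norm x < 1" for x using local_lim[OF that] by simp
    show "E x (J v) = \<i> * E x v" if x: "norm x < 1" for x v
    proof (rule LIMSEQ_unique[OF E[OF x]])
      have "(\<lambda>n. \<i> * D (G n) x v) \<longlonglongrightarrow> \<i> * E x v" by (intro tendsto_intros E x)
      then show "(\<lambda>n. D (G n) x (J v)) \<longlonglongrightarrow> \<i> * E x v" by (simp add: hol_D_J[OF hG x])
    qed
  qed
  have Dg: "D g x = E x" if "norm x < 1" for x
    using local_lim[OF that] by (intro D_eq) simp
  have rad: "radial_bound (G n - g) (108 * e)"
    if N: "\<And>m n. N \<le> m \<Longrightarrow> N \<le> n \<Longrightarrow> radial_bound (G m - G n) e" and n: "N \<le> n" for N n e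
    unfolding radial_bound_def
  proof (intro allI impI)
    fix z :: 'a assume z: "norm z < 1"
    have e: "0 \<le> e" using N[OF n n] by (rule radial_bound_nonneg)
    have "(1 - (norm z)\<^sup>2) * cmod (D (G n - g) z z) \<le> 108 * e * norm z"
      using limD[OF N n z, of z] D_diff[OF hG hg z] Dg[OF z] by simp
    also have "\<dots> \<le> 108 * e" using z e by (simp add: mult_left_le)
    finally show "(1 - (norm z)\<^sup>2) * cmod (D (G n - g) z z) \<le> 108 * e" .
  qed
  have "g \<in> bloch J"
  proof -
    obtain N where N: "\<And>m n. N \<le> m \<Longrightarrow> N \<le> n \<Longrightarrow> radial_bound (G m - G n) 1"
      using cauchy[of 1] by auto
    obtain S where S: "radial_bound (G N) S" using bloch_radial_bound[OF G] by blast
    have "radial_bound g (S + 108 * 1)"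
      unfolding radial_bound_def
    proof (intro allI impI)
      fix z :: 'a assume z: "norm z < 1"
      have "cmod (D g z z) \<le> cmod (D (G N) z z) + cmod (D (G N - g) z z)"
        using norm_triangle_ineq4[of "D (G N) z z" "D (G N - g) z z"] D_diff[OF hG hg z, of N z] by simp
      then have "(1 - (norm z)\<^sup>2) * cmod (D g z z)
          \<le> (1 - (norm z)\<^sup>2) * (cmod (D (G N) z z) + cmod (D (G N - g) z z))"
        using one_minus_norm_sq_pos[OF z] by (intro mult_left_mono) auto
      also have "\<dots> \<le> S + 108 * 1"
        unfolding distrib_left
        using S rad[OF N order_refl] z unfolding radial_bound_def by (intro add_mono) blast+
      finally show "(1 - (norm z)\<^sup>2) * cmod (D g z z) \<le> S + 108 * 1" .
    qed
    then show ?thesis by (rule blochI[OF hg])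
  qed
  moreover have "(\<lambda>n. bloch_norm J (G n - g)) \<longlonglongrightarrow> 0"
  proof (rule LIMSEQ_I)
    fix e :: real assume e: "0 < e"
    \<comment> \<open>Chosen so that \<open>54 * (108 * e')\<close> is \<open>e / 2\<close>; the
      value at 0 takes the other half.\<close>
    define e' where "e' = e / (2 * 54 * 108)"
    have e': "0 < e'" using e by (simp add: e'_def)
    obtain N where N: "\<And>m n. N \<le> m \<Longrightarrow> N \<le> n \<Longrightarrow> radial_bound (G m - G n) e'"
      using cauchy[OF e'] by blast
    have "(\<lambda>n. G n 0) \<longlonglongrightarrow> g 0" using local_lim[of 0] by simp
    then obtain N' where N': "\<And>n. N' \<le> n \<Longrightarrow> cmod (G n 0 - g 0) < e / 2"
      using LIMSEQ_D[of "\<lambda>n. G n 0" "g 0" "e / 2"] e by auto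
    have "norm (bloch_norm J (G n - g) - 0) < e" if "max N N' \<le> n" for n
    proof -
      have n: "N \<le> n" "N' \<le> n" using that by auto
      have r: "radial_bound (G n - g) (108 * e')" by (rule rad[OF N n(1)])
      have "bloch_norm J (G n - g) \<le> cmod ((G n - g) 0) + 54 * (108 * e')"
        by (rule bloch_norm_le[OF hol_diff[OF hG hg] r])
      also have "\<dots> < e" using N'[OF n(2)] by (simp add: e'_def)
      finally show ?thesis
        using bloch_norm_nonneg[OF blochI[OF hol_diff[OF hG hg] r]] by simp
    qed
    then show "\<exists>N. \<forall>n\<ge>N. norm (bloch_norm J (G n - g) - 0) < e" by blast
  qed
  ultimately show ?thesis by blast
qed


section \<open>Compactness of the composition operator\<close>

text \<open>An Arzela-Ascoli argument: a diagonal subsequence converges on the countable union of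
  finite nets of all \<open>K k\<close>, and the common Lipschitz constant on each
  \<open>K k\<close> makes this uniform there.\<close>

lemma bloch_subsequence_compacts:
  fixes K :: "nat \<Rightarrow> 'a set"
  assumes F: "\<And>n. F n \<in> bloch J" and M: "\<And>n. bloch_norm J (F n) \<le> M"
    and K: "\<And>k. compact (K k)" "\<And>k x. x \<in> K k \<Longrightarrow> norm x \<le> \<rho> k" and \<rho>: "\<And>k. \<rho> k < 1"
  obtains r :: "nat \<Rightarrow> nat" where "strict_mono r"
    "\<And>k e. 0 < e \<Longrightarrow> \<exists>N. \<forall>m\<ge>N. \<forall>n\<ge>N. \<forall>x\<in>K k. cmod (F (r m) x - F (r n) x) < e"
proof -
  have "\<exists>C. finite C \<and> C \<subseteq> K k \<and> K k \<subseteq> (\<Union>x\<in>C. ball x (1 / real (Suc j)))" for k j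
    using seq_compact_imp_totally_bounded[of "K k"] compact_imp_seq_compact[OF K(1)[of k]] by simp
  then obtain C where C: "\<And>k j. finite (C k j)" "\<And>k j. C k j \<subseteq> K k"
    "\<And>k j. K k \<subseteq> (\<Union>x\<in>C k j. ball x (1 / real (Suc j)))"
    by metis
  define T where "T = (\<Union>k j. C k j)"
  have T: "countable T" unfolding T_def by (intro countable_UN countableI_type countable_finite C(1))
  have T1: "norm x < 1" if x: "x \<in> T" for x
  proof -
    obtain k where "x \<in> K k" using x C(2) unfolding T_def by blast
    then show ?thesis using K(2) \<rho> by (meson le_less_trans)
  qed
  \<comment> \<open>The diagonal theorem asks for one bound at all points; the weight supplies
    \<open>3 * M\<close> and is divided out afterwards.\<close>
  obtain r :: "nat \<Rightarrow> nat" where r: "strict_mono r"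
    and conv: "\<And>x. x \<in> T \<Longrightarrow> \<exists>l. (\<lambda>n. complex_of_real (1 - (norm x)\<^sup>2) * F (r n) x) \<longlonglongrightarrow> l"
  proof (rule function_convergent_subsequence[OF T, of "\<lambda>n x. complex_of_real (1 - (norm x)\<^sup>2) * F n x" "3 * M"])
    fix n x assume "x \<in> T"
    then have x: "norm x < 1" by (rule T1)
    have "cmod (complex_of_real (1 - (norm x)\<^sup>2) * F n x) = (1 - (norm x)\<^sup>2) * cmod (F n x)"
      using one_minus_norm_sq_pos[OF x] by (simp only: norm_mult norm_of_real abs_of_pos)
    then show "cmod (complex_of_real (1 - (norm x)\<^sup>2) * F n x) \<le> 3 * M"
      using bloch_growth[OF F M x] by simp
  qed blast
  have cauchy: "Cauchy (\<lambda>n. F (r n) x)" if x: "x \<in> T" for x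
  proof -
    obtain l where l: "(\<lambda>n. complex_of_real (1 - (norm x)\<^sup>2) * F (r n) x) \<longlonglongrightarrow> l"
      using conv[OF x] by blast
    have nz: "complex_of_real (1 - (norm x)\<^sup>2) \<noteq> 0"
      using one_minus_norm_sq_pos[OF T1[OF x]] by (simp only: of_real_eq_0_iff)
    have "(\<lambda>n. complex_of_real (1 - (norm x)\<^sup>2) * F (r n) x / complex_of_real (1 - (norm x)\<^sup>2))
        \<longlonglongrightarrow> l / complex_of_real (1 - (norm x)\<^sup>2)"
      by (intro tendsto_divide l tendsto_const nz)
    then have "(\<lambda>n. F (r n) x) \<longlonglongrightarrow> l / complex_of_real (1 - (norm x)\<^sup>2)"
      by (simp only: nonzero_mult_div_cancel_left[OF nz])
    then show ?thesis by (rule LIMSEQ_imp_Cauchy)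
  qed
  have "\<exists>N. \<forall>m\<ge>N. \<forall>n\<ge>N. \<forall>x\<in>K k. cmod (F (r m) x - F (r n) x) < e" if e: "0 < e" for k e
  proof -
    define L where "L = 2 * M / (1 - (\<rho> k)\<^sup>2)"
    \<comment> \<open>The mesh is so fine that the Lipschitz error is below \<open>e / 3\<close>;
      \<open>\<bar>L\<bar> + 1\<close> is a positive majorant of \<open>L\<close>.\<close>
    obtain j where "(\<bar>L\<bar> + 1) / (e / 3) < real j" using reals_Archimedean2 by blast
    then have j: "(\<bar>L\<bar> + 1) / (e / 3) < real (Suc j)" by simp
    have "\<bar>L\<bar> + 1 < (e / 3) * real (Suc j)" using j e by (simp add: field_simps)
    then have Lj: "(\<bar>L\<bar> + 1) * (1 / real (Suc j)) < e / 3" by (simp add: field_simps)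
    have near: "cmod (F n x - F n y) < e / 3"
      if "x \<in> K k" "y \<in> K k" "dist x y < 1 / real (Suc j)" for n x y
    proof -
      have "cmod (F n x - F n y) \<le> L * norm (x - y)"
        unfolding L_def by (rule bloch_lipschitz[OF F M \<rho> K(2) K(2)]) (use that in auto)
      also have "\<dots> \<le> (\<bar>L\<bar> + 1) * norm (x - y)" by (intro mult_right_mono) auto
      also have "\<dots> \<le> (\<bar>L\<bar> + 1) * (1 / real (Suc j))"
        using that(3) by (intro mult_left_mono) (auto simp: dist_norm)
      finally show ?thesis using Lj by linarith
    qed
    have "\<forall>y\<in>C k j. \<exists>N. \<forall>m\<ge>N. \<forall>n\<ge>N. cmod (F (r m) y - F (r n) y) < e / 3"
    proof
      fix y assume "y \<in> C k j"
      then have "Cauchy (\<lambda>n. F (r n) y)" by (intro cauchy) (auto simp: T_def)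
      then show "\<exists>N. \<forall>m\<ge>N. \<forall>n\<ge>N. cmod (F (r m) y - F (r n) y) < e / 3"
        using CauchyD[of "\<lambda>n. F (r n) y" "e / 3"] e by simp
    qed
    then obtain N where N: "\<And>y m n. y \<in> C k j \<Longrightarrow> N y \<le> m \<Longrightarrow> N y \<le> n \<Longrightarrow> cmod (F (r m) y - F (r n) y) < e / 3"
      by metis
    \<comment> \<open>Inserting 0 keeps the maximum meaningful when the net is empty.\<close>
    define N0 where "N0 = Max (insert 0 (N ` C k j))"
    have N0: "N y \<le> N0" if "y \<in> C k j" for y
      unfolding N0_def using that C(1) by (intro Max_ge) auto
    have "cmod (F (r m) x - F (r n) x) < e" if mn: "N0 \<le> m" "N0 \<le> n" and x: "x \<in> K k" for m n x
    proof -
      obtain y where y: "y \<in> C k j" "dist x y < 1 / real (Suc j)"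
        using C(3)[of k j] x by (auto simp: dist_commute)
      then have yK: "y \<in> K k" using C(2) by blast
      have "cmod (F (r m) x - F (r n) x)
          \<le> cmod (F (r m) x - F (r m) y) + cmod (F (r m) y - F (r n) y) + cmod (F (r n) y - F (r n) x)"
        by norm
      moreover have "cmod (F (r m) x - F (r m) y) < e / 3" by (rule near[OF x yK y(2)])
      moreover have "cmod (F (r n) y - F (r n) x) < e / 3"
        using near[OF yK x] y(2) by (simp add: dist_commute)
      moreover have "cmod (F (r m) y - F (r n) y) < e / 3"
        using N[OF y(1)] N0[OF y(1)] mn by (meson order_trans)
      ultimately show ?thesis by linarith
    qed
    then show ?thesis by blast
  qed
  then show thesis using that r by blast
qed

end

section \<open>The symbol \<open>\<phi>\<close> and its weighted radial derivative\<close>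

locale compact_symbol = complex_hilbert J for J :: "'a::{real_inner, complete_space} \<Rightarrow> 'a" +
  fixes \<phi> :: "'a \<Rightarrow> 'a"
  assumes holo: "holo_on J J (ball 0 1) \<phi>"
    and self_map: "z \<in> ball 0 1 \<Longrightarrow> \<phi> z \<in> ball 0 1"
    and compact_values: "0 < \<delta> \<Longrightarrow> \<delta> < 1 \<Longrightarrow>
      compact (closure {\<phi> z | z. z \<in> ball 0 1 \<and> norm (\<phi> z) \<le> \<delta>})"
    and compact_radial: "0 < \<delta> \<Longrightarrow> \<delta> < 1 \<Longrightarrow>
      compact (closure {(1 - (norm z)\<^sup>2) *\<^sub>R radial_deriv \<phi> z | z. z \<in> ball 0 1 \<and> norm (\<phi> z) \<le> \<delta>})"
    and little_tangential: "0 < \<epsilon> \<Longrightarrow> \<exists>r<1. \<forall>z\<in>ball 0 1. norm (\<phi> z) > r \<longrightarrow>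
      \<bar>(1 - (norm z)\<^sup>2) * norm (radial_deriv \<phi> z) / sqrt (1 - (norm (\<phi> z))\<^sup>2)\<bar> < \<epsilon>"
    and little_normal: "0 < \<epsilon> \<Longrightarrow> \<exists>r<1. \<forall>z\<in>ball 0 1. norm (\<phi> z) > r \<longrightarrow>
      \<bar>(1 - (norm z)\<^sup>2) * cmod (cinner J (\<phi> z) (radial_deriv \<phi> z)) / (1 - (norm (\<phi> z))\<^sup>2)\<bar> < \<epsilon>"
begin

definition wrad :: "'a \<Rightarrow> 'a" where
  "wrad z = (1 - (norm z)\<^sup>2) *\<^sub>R radial_deriv \<phi> z"

lemma norm_\<phi>_less: "norm z < 1 \<Longrightarrow> norm (\<phi> z) < 1"
  using self_map by simp

lemma \<phi>_has_derivative:
  assumes "norm z < 1"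
  obtains E where "(\<phi> has_derivative E) (at z)" "\<And>v. E (J v) = J (E v)" "radial_deriv \<phi> z = E z"
proof -
  obtain E where E: "(\<phi> has_derivative E) (at z)" "\<And>v. E (J v) = J (E v)"
    using holo assms unfolding holo_on_def by (metis mem_ball_0)
  then have "radial_deriv \<phi> z = E z"
    unfolding radial_deriv_def using frechet_derivative_at by metis
  then show ?thesis using that E by blast
qed

lemma hol_comp:
  assumes f: "hol f"
  shows "hol (f \<circ> \<phi>)"
  unfolding holo_on_def
proof
  fix z :: 'a assume "z \<in> ball 0 1"
  then have z: "norm z < 1" by simp
  obtain E where E: "(\<phi> has_derivative E) (at z)" "\<And>v. E (J v) = J (E v)"
    using \<phi>_has_derivative[OF z] by blast
  have "(f \<circ> \<phi> has_derivative (\<lambda>v. D f (\<phi> z) (E v))) (at z)"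
    unfolding o_def by (rule has_derivative_compose[OF E(1) hol_has_derivative[OF f norm_\<phi>_less[OF z]]])
  moreover have "D f (\<phi> z) (E (J v)) = \<i> * D f (\<phi> z) (E v)" for v
    unfolding E(2) by (rule hol_D_J[OF f norm_\<phi>_less[OF z]])
  ultimately show "\<exists>E. (f \<circ> \<phi> has_derivative E) (at z) \<and> (\<forall>v. E (J v) = \<i> * E v)" by blast
qed

text \<open>The chain rule, with the weight moved inside the vector, so that conditions (i) to (iii)
  speak about \<open>wrad z\<close>.\<close>

lemma D_comp:
  assumes f: "hol f" and z: "norm z < 1"
  shows "(1 - (norm z)\<^sup>2) * cmod (D (f \<circ> \<phi>) z z) = cmod (D f (\<phi> z) (wrad z))"
proof -
  obtain E where E: "(\<phi> has_derivative E) (at z)" "radial_deriv \<phi> z = E z"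
    using \<phi>_has_derivative[OF z] by blast
  have "(f \<circ> \<phi> has_derivative (\<lambda>v. D f (\<phi> z) (E v))) (at z)"
    unfolding o_def by (rule has_derivative_compose[OF E(1) hol_has_derivative[OF f norm_\<phi>_less[OF z]]])
  then have "D (f \<circ> \<phi>) z = (\<lambda>v. D f (\<phi> z) (E v))" by (rule D_eq)
  then show ?thesis
    using one_minus_norm_sq_pos[OF z]
    by (simp add: wrad_def E(2) hol_D_scaleR[OF f norm_\<phi>_less[OF z]])
qed

text \<open>Near the sphere \<open>wrad z\<close> is \<open>anis (\<phi> z) v\<close> with
  \<open>norm v \<le> \<epsilon>\<close>. The threshold \<open>\<delta>\<close> is chosen before
  \<open>f\<close>, which gives uniformity over bounded families.\<close>

lemma comp_small_near_boundary:
  assumes \<epsilon>: "0 < \<epsilon>"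
  obtains \<delta> where "0 < \<delta>" "\<delta> < 1"
    "\<And>f z B. (\<And>a v. norm a < 1 \<Longrightarrow> cmod (D f a (anis a v)) \<le> B * norm v) \<Longrightarrow> 0 \<le> B \<Longrightarrow>
      norm z < 1 \<Longrightarrow> \<delta> < norm (\<phi> z) \<Longrightarrow> cmod (D f (\<phi> z) (wrad z)) \<le> B * \<epsilon>"
proof -
  have \<epsilon>3: "0 < \<epsilon> / 3" using \<epsilon> by simp
  obtain r1 where r1: "r1 < 1" "\<And>z. norm z < 1 \<Longrightarrow> r1 < norm (\<phi> z) \<Longrightarrow>
      \<bar>(1 - (norm z)\<^sup>2) * norm (radial_deriv \<phi> z) / sqrt (1 - (norm (\<phi> z))\<^sup>2)\<bar> < \<epsilon> / 3"
    using little_tangential[OF \<epsilon>3] by auto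
  obtain r2 where r2: "r2 < 1" "\<And>z. norm z < 1 \<Longrightarrow> r2 < norm (\<phi> z) \<Longrightarrow>
      \<bar>(1 - (norm z)\<^sup>2) * cmod (cinner J (\<phi> z) (radial_deriv \<phi> z)) / (1 - (norm (\<phi> z))\<^sup>2)\<bar> < \<epsilon> / 3"
    using little_normal[OF \<epsilon>3] by auto
  \<comment> \<open>The lower bound 1/2 replaces the division by \<open>norm (\<phi> z)\<close> in
    \<open>norm_cproj\<close> by a factor 2; the shares are then \<open>\<epsilon> / 3\<close> and
    \<open>2 * (\<epsilon> / 3)\<close>.\<close>
  define \<delta> where "\<delta> = max (1/2) (max r1 r2)"
  show thesis
  proof (rule that[of \<delta>])
    show "0 < \<delta>" "\<delta> < 1" using r1(1) r2(1) by (auto simp: \<delta>_def)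
    fix f z B
    assume B: "\<And>a v. norm a < 1 \<Longrightarrow> cmod (D f a (anis a v)) \<le> B * norm v" "0 \<le> B"
      and z: "norm z < 1" and big: "\<delta> < norm (\<phi> z)"
    let ?w = "\<phi> z"
    have w: "norm ?w < 1" using z by (rule norm_\<phi>_less)
    have s: "0 < 1 - (norm ?w)\<^sup>2" using w by (rule one_minus_norm_sq_pos)
    have sz: "0 < 1 - (norm z)\<^sup>2" using z by (rule one_minus_norm_sq_pos)
    have w2: "1/2 \<le> norm ?w" "r1 < norm ?w" "r2 < norm ?w" using big by (auto simp: \<delta>_def)
    obtain v where v: "anis ?w v = wrad z"
      "norm v \<le> norm (wrad z) / sqrt (1 - (norm ?w)\<^sup>2) + norm (cproj ?w (wrad z)) / (1 - (norm ?w)\<^sup>2)"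
      using anis_preimage[OF w] by blast
    have 1: "norm (wrad z) / sqrt (1 - (norm ?w)\<^sup>2) \<le> \<epsilon> / 3"
      using r1(2)[OF z w2(2)] sz by (simp add: wrad_def abs_if split: if_splits)
    have "norm (cproj ?w (wrad z)) = (1 - (norm z)\<^sup>2) * cmod (cinner J ?w (radial_deriv \<phi> z)) / norm ?w"
      unfolding norm_cproj wrad_def cinner_scaleR_left norm_mult norm_of_real abs_of_pos[OF sz]
        cmod_cinner_commute[of "radial_deriv \<phi> z" "\<phi> z"] by (rule refl)
    also have "\<dots> \<le> (1 - (norm z)\<^sup>2) * cmod (cinner J ?w (radial_deriv \<phi> z)) / (1/2)"
      using w2 sz by (intro divide_left_mono) auto
    finally have "norm (cproj ?w (wrad z)) / (1 - (norm ?w)\<^sup>2)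
        \<le> 2 * ((1 - (norm z)\<^sup>2) * cmod (cinner J ?w (radial_deriv \<phi> z)) / (1 - (norm ?w)\<^sup>2))"
      using s by (simp add: divide_right_mono)
    also have "\<dots> \<le> 2 * (\<epsilon> / 3)"
      using r2(2)[OF z w2(3)] by (intro mult_left_mono order_trans[OF abs_ge_self less_imp_le]) auto
    finally have "norm v \<le> \<epsilon>" using v(2) 1 by linarith
    then have "B * norm v \<le> B * \<epsilon>" using B(2) by (intro mult_left_mono)
    then show "cmod (D f ?w (wrad z)) \<le> B * \<epsilon>" using B(1)[OF w, of v] v(1) by simp
  qed
qed

lemma wrad_bounded:
  assumes "0 < \<delta>" "\<delta> < 1"
  obtains b where "0 < b" "\<And>z. norm z < 1 \<Longrightarrow> norm (\<phi> z) \<le> \<delta> \<Longrightarrow> norm (wrad z) \<le> b"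
proof -
  have "bounded {(1 - (norm z)\<^sup>2) *\<^sub>R radial_deriv \<phi> z | z. z \<in> ball 0 1 \<and> norm (\<phi> z) \<le> \<delta>}"
    by (rule bounded_subset[OF compact_imp_bounded[OF compact_radial[OF assms]] closure_subset])
  then obtain b where b: "0 < b" "\<And>x. x \<in> {(1 - (norm z)\<^sup>2) *\<^sub>R radial_deriv \<phi> z | z.
      z \<in> ball 0 1 \<and> norm (\<phi> z) \<le> \<delta>} \<Longrightarrow> norm x \<le> b"
    unfolding bounded_pos by blast
  show ?thesis
  proof (rule that[OF b(1)])
    show "norm (wrad z) \<le> b" if "norm z < 1" "norm (\<phi> z) \<le> \<delta>" for z
      unfolding wrad_def using that by (intro b(2)) auto
  qed
qed

text \<open>Near the sphere the previous estimate with \<open>\<epsilon> = 1\<close> suffices.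
  Elsewhere \<open>wrad z\<close> is bounded by (i) and the Bloch weight at \<open>\<phi> z\<close>
  is at least \<open>1 - \<delta>\<^sup>2\<close>.\<close>

lemma comp_bloch:
  assumes f: "f \<in> bloch J"
  shows "f \<circ> \<phi> \<in> bloch J"
proof -
  let ?B = "bloch_norm J f"
  have B: "0 \<le> ?B" using f by (rule bloch_norm_nonneg)
  have hf: "hol f" using f by (rule bloch_hol)
  obtain \<delta> where \<delta>: "0 < \<delta>" "\<delta> < 1"
    "\<And>z. norm z < 1 \<Longrightarrow> \<delta> < norm (\<phi> z) \<Longrightarrow> cmod (D f (\<phi> z) (wrad z)) \<le> ?B * 1"
    using comp_small_near_boundary[of 1] anis_le_bloch_norm[OF f] B by (metis zero_less_one)
  obtain b where b: "0 < b" "\<And>z. norm z < 1 \<Longrightarrow> norm (\<phi> z) \<le> \<delta> \<Longrightarrow> norm (wrad z) \<le> b"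
    using wrad_bounded[OF \<delta>(1,2)] by blast
  have s\<delta>: "0 < 1 - \<delta>\<^sup>2" using \<delta>(1,2) by (simp add: abs_square_less_1)
  have "radial_bound (f \<circ> \<phi>) (?B + 2 * ?B * b / (1 - \<delta>\<^sup>2))"
    unfolding radial_bound_def
  proof (intro allI impI)
    fix z :: 'a assume z: "norm z < 1"
    have w: "norm (\<phi> z) < 1" using z by (rule norm_\<phi>_less)
    show "(1 - (norm z)\<^sup>2) * cmod (D (f \<circ> \<phi>) z z) \<le> ?B + 2 * ?B * b / (1 - \<delta>\<^sup>2)"
    proof (cases "\<delta> < norm (\<phi> z)")
      case True
      have "0 \<le> 2 * ?B * b / (1 - \<delta>\<^sup>2)" using B b s\<delta> by simp
      then show ?thesis using \<delta>(3)[OF z True] D_comp[OF hf z] by simp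
    next
      case False
      then have le: "norm (\<phi> z) \<le> \<delta>" by simp
      have "(1 - \<delta>\<^sup>2) * cmod (D f (\<phi> z) (wrad z)) \<le> (1 - (norm (\<phi> z))\<^sup>2) * cmod (D f (\<phi> z) (wrad z))"
        using power_mono[OF le, of 2] by (intro mult_right_mono) auto
      also have "\<dots> \<le> 2 * ?B * norm (wrad z)"
        by (rule D_le_of_anis[OF w anis_le_bloch_norm[OF f w]])
      also have "\<dots> \<le> 2 * ?B * b" using b(2)[OF z le] B by (intro mult_left_mono) auto
      finally have "cmod (D f (\<phi> z) (wrad z)) \<le> 2 * ?B * b / (1 - \<delta>\<^sup>2)"
        using s\<delta> by (simp add: pos_le_divide_eq mult.commute)
      then show ?thesis using D_comp[OF hf z] B by simp
    qed
  qed
  then show ?thesis by (rule blochI[OF hol_comp[OF hf]])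
qed

text \<open>Letting values, radial vectors and scalars vary independently makes \<open>K\<close> a
  continuous image of a product of three compact sets.\<close>

lemma compact_neighbourhood:
  assumes \<delta>: "0 < \<delta>" "\<delta> < 1"
  shows "\<exists>K \<rho> \<eta>. compact K \<and> (\<forall>x\<in>K. norm x \<le> \<rho>) \<and> \<rho> < 1 \<and> 0 < \<eta> \<and>
    (\<forall>z c. norm z < 1 \<longrightarrow> norm (\<phi> z) \<le> \<delta> \<longrightarrow> cmod c \<le> \<eta> \<longrightarrow> \<phi> z + cscale J c (wrad z) \<in> K)"
proof -
  let ?A = "closure {\<phi> z | z. z \<in> ball 0 1 \<and> norm (\<phi> z) \<le> \<delta>}"
  let ?U = "closure {(1 - (norm z)\<^sup>2) *\<^sub>R radial_deriv \<phi> z | z. z \<in> ball 0 1 \<and> norm (\<phi> z) \<le> \<delta>}"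
  obtain b where b: "0 < b" "\<And>u. u \<in> ?U \<Longrightarrow> norm u \<le> b"
    using compact_imp_bounded[OF compact_radial[OF \<delta>]] unfolding bounded_pos by blast
  \<comment> \<open>The shift is then at most \<open>\<eta> * b = (1 - \<delta>) / 2\<close>, and
    norms stay below \<open>(1 + \<delta>) / 2\<close>.\<close>
  define \<eta> where "\<eta> = (1 - \<delta>) / (2 * b)"
  have \<eta>: "0 < \<eta>" using \<delta> b by (simp add: \<eta>_def)
  define K where "K = (\<lambda>(w, u, c). w + cscale J c u) ` (?A \<times> ?U \<times> cball (0::complex) \<eta>)"
  have "compact (?A \<times> ?U \<times> cball (0::complex) \<eta>)"
    by (intro compact_Times compact_values compact_radial \<delta> compact_cball)
  moreover have "continuous_on UNIV (\<lambda>(w, u, c). w + cscale J c u)"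
    unfolding case_prod_beta
    by (intro continuous_on_add bounded_bilinear.continuous_on[OF bounded_bilinear_cscale]
        continuous_on_fst continuous_on_snd continuous_on_id)
  ultimately have "compact K"
    unfolding K_def using compact_continuous_image continuous_on_subset by blast
  moreover have "norm x \<le> (1 + \<delta>) / 2" if xK: "x \<in> K" for x
  proof -
    obtain w u c where x: "x = w + cscale J c u" "w \<in> ?A" "u \<in> ?U" "cmod c \<le> \<eta>"
      using xK unfolding K_def by auto
    have "?A \<subseteq> cball 0 \<delta>" by (intro closure_minimal) auto
    then have "norm w \<le> \<delta>" using x(2) by auto
    moreover have "cmod c * norm u \<le> \<eta> * b" using x b \<eta> by (intro mult_mono) auto
    moreover have "\<eta> * b = (1 - \<delta>) / 2" using b by (simp add: \<eta>_def)
    ultimately show ?thesis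
      using norm_triangle_ineq[of w "cscale J c u"] unfolding x(1) norm_cscale by (simp add: field_simps)
  qed
  moreover have "\<phi> z + cscale J c (wrad z) \<in> K"
    if z: "norm z < 1" "norm (\<phi> z) \<le> \<delta>" and c: "cmod c \<le> \<eta>" for z c
  proof -
    have "\<phi> z \<in> ?A" using z by (intro subsetD[OF closure_subset]) auto
    moreover have "wrad z \<in> ?U" using z by (intro subsetD[OF closure_subset]) (auto simp: wrad_def)
    ultimately show ?thesis
      unfolding K_def using c by (intro image_eqI[of _ _ "(\<phi> z, wrad z, c)"]) auto
  qed
  moreover have "(1 + \<delta>) / 2 < 1" using \<delta> by simp
  ultimately show ?thesis using \<eta> by blast
qed

text \<open>One subsequence is extracted for all levels \<open>d k\<close> at once; for a given
  \<open>e\<close> a level beyond the boundary threshold is then selected.\<close>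

lemma comp_subsequence:
  assumes F: "\<And>n. F n \<in> bloch J" and M: "\<And>n. bloch_norm J (F n) \<le> M"
  shows "\<exists>r g. strict_mono (r :: nat \<Rightarrow> nat) \<and> g \<in> bloch J \<and>
    (\<lambda>n. bloch_norm J ((F (r n) \<circ> \<phi>) - g)) \<longlonglongrightarrow> 0"
proof -
  \<comment> \<open>The offset 2 gives \<open>d 0 = 1/2\<close>, so every level lies strictly
    between 0 and 1.\<close>
  define d where "d k = 1 - 1 / real (k + 2)" for k
  have d: "0 < d k" "d k < 1" for k by (auto simp: d_def field_simps)
  have d_cofinal: "\<exists>k. t \<le> d k" if "t < 1" for t
  proof -
    obtain k where "1 / (1 - t) < real k" using reals_Archimedean2 by blast
    then have "1 / (1 - t) \<le> real (k + 2)" by simp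
    then have "t \<le> d k" using that by (simp add: d_def field_simps)
    then show ?thesis ..
  qed
  define Q where "Q k K \<rho> \<eta> \<longleftrightarrow> compact K \<and> (\<forall>x\<in>K. norm x \<le> \<rho>) \<and> \<rho> < 1 \<and> 0 < \<eta> \<and>
    (\<forall>z c. norm z < 1 \<longrightarrow> norm (\<phi> z) \<le> d k \<longrightarrow> cmod c \<le> \<eta> \<longrightarrow> \<phi> z + cscale J c (wrad z) \<in> K)"
    for k K \<rho> \<eta>
  have "\<exists>K \<rho> \<eta>. Q k K \<rho> \<eta>" for k
    unfolding Q_def by (rule compact_neighbourhood[OF d])
  then obtain K \<rho> \<eta> where "\<And>k. Q k (K k) (\<rho> k) (\<eta> k)" by metis
  then have K: "\<And>k. compact (K k)" "\<And>k x. x \<in> K k \<Longrightarrow> norm x \<le> \<rho> k" "\<And>k. \<rho> k < 1"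
    "\<And>k. 0 < \<eta> k"
    "\<And>k z c. norm z < 1 \<Longrightarrow> norm (\<phi> z) \<le> d k \<Longrightarrow> cmod c \<le> \<eta> k \<Longrightarrow> \<phi> z + cscale J c (wrad z) \<in> K k"
    by (simp_all add: Q_def)
  obtain r :: "nat \<Rightarrow> nat" where r: "strict_mono r"
    and uc: "\<And>k e. 0 < e \<Longrightarrow> \<exists>N. \<forall>m\<ge>N. \<forall>n\<ge>N. \<forall>x\<in>K k. cmod (F (r m) x - F (r n) x) < e"
    using bloch_subsequence_compacts[where F = F and K = K and \<rho> = \<rho>, OF F M K(1,2,3)] by blast
  define G where "G n = F (r n) \<circ> \<phi>" for n
  have hF: "hol (F n)" for n using F by (rule bloch_hol)
  have M0: "0 \<le> M" using bloch_norm_nonneg[OF F] M order_trans by blast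
  have GB: "G n \<in> bloch J" for n unfolding G_def using F by (rule comp_bloch)
  have "\<exists>N. \<forall>m\<ge>N. \<forall>n\<ge>N. radial_bound (G m - G n) e" if e: "0 < e" for e
  proof -
    \<comment> \<open>Differences of two members obey the invariant bound \<open>2 * M\<close>;
      adding 1 covers \<open>M = 0\<close>.\<close>
    define \<epsilon> where "\<epsilon> = e / (2 * M + 1)"
    have \<epsilon>: "0 < \<epsilon>" "2 * M * \<epsilon> \<le> e" using e M0 by (auto simp: \<epsilon>_def field_simps)
    obtain \<delta> where \<delta>: "0 < \<delta>" "\<delta> < 1"
      "\<And>f z B. (\<And>a v. norm a < 1 \<Longrightarrow> cmod (D f a (anis a v)) \<le> B * norm v) \<Longrightarrow> 0 \<le> B \<Longrightarrow>
        norm z < 1 \<Longrightarrow> \<delta> < norm (\<phi> z) \<Longrightarrow> cmod (D f (\<phi> z) (wrad z)) \<le> B * \<epsilon>"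
      using comp_small_near_boundary[OF \<epsilon>(1)] by blast
    obtain k where k: "\<delta> \<le> d k" using d_cofinal[OF \<delta>(2)] by blast
    \<comment> \<open>Cauchy's estimate on discs of parameter radius \<open>\<eta> k\<close> divides
      by \<open>\<eta> k\<close>, so values must be within \<open>e * \<eta> k\<close>.\<close>
    have "0 < e * \<eta> k" using e K(4) by simp
    then obtain N where N: "\<And>m n x. N \<le> m \<Longrightarrow> N \<le> n \<Longrightarrow> x \<in> K k \<Longrightarrow> cmod (F (r m) x - F (r n) x) < e * \<eta> k"
      using uc by metis
    have "radial_bound (G m - G n) e" if mn: "N \<le> m" "N \<le> n" for m n
      unfolding radial_bound_def
    proof (intro allI impI)
      fix z :: 'a assume z: "norm z < 1"
      let ?h = "F (r m) - F (r n)"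
      have h: "hol ?h" using hF hF by (rule hol_diff)
      have G: "G m - G n = ?h \<circ> \<phi>" by (simp add: G_def fun_eq_iff)
      have "cmod (D ?h (\<phi> z) (wrad z)) \<le> e"
      proof (cases "\<delta> < norm (\<phi> z)")
        case True
        have "cmod (D ?h a (anis a v)) \<le> 2 * M * norm v" if a: "norm a < 1" for a v
        proof -
          have *: "cmod (D (F j) a (anis a v)) \<le> M * norm v" for j
            using anis_le_bloch_norm[OF F a, of j v] mult_right_mono[OF M[of j] norm_ge_zero[of v]]
            by (rule order_trans)
          show ?thesis
            unfolding D_diff[OF hF hF a]
            using norm_triangle_ineq4[of "D (F (r m)) a (anis a v)" "D (F (r n)) a (anis a v)"]
              *[of "r m"] *[of "r n"] by simp
        qed
        then have "cmod (D ?h (\<phi> z) (wrad z)) \<le> 2 * M * \<epsilon>" using M0 by (intro \<delta>(3) z True) auto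
        then show ?thesis using \<epsilon>(2) by simp
      next
        case False
        then have le: "norm (\<phi> z) \<le> d k" using k by simp
        have mem: "\<phi> z + cscale J c (wrad z) \<in> K k" if "cmod c \<le> \<eta> k" for c
          by (rule K(5)[OF z le that])
        have "cmod (D ?h (\<phi> z) (wrad z)) \<le> (e * \<eta> k) / \<eta> k"
        proof (rule cauchy_estimate[OF h K(4)])
          show "norm (\<phi> z + cscale J c (wrad z)) < 1" if "cmod c \<le> \<eta> k" for c
            using K(2)[OF mem[OF that]] K(3)[of k] by linarith
          show "cmod (?h (\<phi> z + cscale J c (wrad z))) \<le> e * \<eta> k" if "cmod c = \<eta> k" for c
            using N[OF mn mem[of c]] that by simp
        qed
        also have "\<dots> = e" using K(4)[of k] by simp
        finally show ?thesis .
      qed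
      then show "(1 - (norm z)\<^sup>2) * cmod (D (G m - G n) z z) \<le> e"
        unfolding G using D_comp[OF h z] by simp
    qed
    then show ?thesis by blast
  qed
  \<comment> \<open>The point \<open>\<phi> 0\<close> is the centre of one of the discs, hence lies
    in some \<open>K k\<close>.\<close>
  moreover have "convergent (\<lambda>n. G n 0)"
  proof -
    obtain k where k: "norm (\<phi> 0) \<le> d k" using d_cofinal norm_\<phi>_less[of 0] by auto
    have mem: "\<phi> 0 \<in> K k" using K(5)[of 0 k 0] k less_imp_le[OF K(4)[of k]] by simp
    have "Cauchy (\<lambda>n. G n 0)"
      unfolding G_def o_def by (rule CauchyI) (use uc[of _ k] mem in blast)
    then show ?thesis by (simp add: Cauchy_convergent_iff)
  qed
  then obtain l where "(\<lambda>n. G n 0) \<longlonglongrightarrow> l" unfolding convergent_def by blast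
  ultimately obtain g where "g \<in> bloch J" "(\<lambda>n. bloch_norm J (G n - g)) \<longlonglongrightarrow> 0"
    using bloch_complete_radial[where G = G, OF GB] by blast
  then show ?thesis using r unfolding G_def by blast
qed

lemma compact_composition: "compact_composition_bloch J \<phi>"
  unfolding compact_composition_bloch_def
  by (intro conjI ballI allI impI comp_bloch comp_subsequence) auto

end

theorem theorem4p13:
  fixes J :: "'a::{real_inner, complete_space} \<Rightarrow> 'a"
    and \<phi> :: "'a \<Rightarrow> 'a"
  assumes J: "complex_structure J"
    and holo: "holo_on J J (ball 0 1) \<phi>"
    and self_map: "\<And>z. z \<in> ball 0 1 \<Longrightarrow> \<phi> z \<in> ball 0 1"
    and i_1: "\<And>\<delta>. 0 < \<delta> \<Longrightarrow> \<delta> < 1 \<Longrightarrow>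
               compact (closure {\<phi> z | z. z \<in> ball 0 1 \<and> norm (\<phi> z) \<le> \<delta>})"
    and i_2: "\<And>\<delta>. 0 < \<delta> \<Longrightarrow> \<delta> < 1 \<Longrightarrow>
               compact (closure {(1 - (norm z)\<^sup>2) *\<^sub>R radial_deriv \<phi> z | z.
                                   z \<in> ball 0 1 \<and> norm (\<phi> z) \<le> \<delta>})"
    and ii: "\<And>\<epsilon>. 0 < \<epsilon> \<Longrightarrow> \<exists>r<1. \<forall>z\<in>ball 0 1. norm (\<phi> z) > r \<longrightarrow>
               \<bar>(1 - (norm z)\<^sup>2) * norm (radial_deriv \<phi> z) / sqrt (1 - (norm (\<phi> z))\<^sup>2)\<bar> < \<epsilon>"
    and iii: "\<And>\<epsilon>. 0 < \<epsilon> \<Longrightarrow> \<exists>r<1. \<forall>z\<in>ball 0 1. norm (\<phi> z) > r \<longrightarrow>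
               \<bar>(1 - (norm z)\<^sup>2) * cmod (cinner J (\<phi> z) (radial_deriv \<phi> z))
                  / (1 - (norm (\<phi> z))\<^sup>2)\<bar> < \<epsilon>"
  shows "compact_composition_bloch J \<phi>"
proof -
  interpret compact_symbol J \<phi>
    by unfold_locales (fact J holo self_map i_1 i_2 ii iii)+
  show ?thesis by (rule compact_composition)
qed

end
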